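(* Let $\Gamma=\langle\alpha_1,\ldots,\alpha_r\rangle\subset A$. There exist a finitely generated $A$-graded commutative $\Bbbk$-algebra $R$ and a sequence $M_2,M_3,M_4,\ldots$ of finitely generated, modestly $A$-graded $R$-modules such that, for every $j\ge 2$ and every $\alpha\in A$, $\mathcal H(M_j;\alpha)>0$ if and only if $\alpha\in\Gamma$ and $\alpha$ has a non-redundant pair $(\mathbf a,\mathbf b)$ of factorizations with $d(\mathbf a,\mathbf b)=j$. In particular, for all $\alpha\in\Gamma$, $$\mathsf c(\alpha)=\max\{j:\mathcal H(M_j;\alpha)>0\},$$ where the maximum of the empty set is taken to be $0$.
   Context: $\mathbb N=\{0,1,2,\ldots\}$, $\Bbbk$ is an arbitrary field, $T$ is a finite abelian group, $d\ge1$, and $A=\mathbb N^d\oplus T$. $\Gamma=\langle\alpha_1,\ldots,\alpha_r\rangle\subset A$ is a finitely generated subsemigroup (containing $0$) that is reduced ($0$ is its only invertible element), with unique minimal generating set $\alpha_1,\ldots,\alpha_r$. A factorization of $\alpha\in\Gamma$ is a tuple $\mathbf a\in\mathbb N^r$ with $\alpha=a_1\alpha_1+\cdots+a_r\alpha_r$; $\mathsf Z_\Gamma(\alpha)$ is the set of factorizations of $\alpha$, and $|\mathbf a|=a_1+\cdots+a_r$. Catenary degree: for $\mathbf a,\mathbf b\in\mathsf Z_\Gamma(\alpha)$, $\gcd(\mathbf a,\mathbf b)=(\min(a_1,b_1),\ldots,\min(a_r,b_r))$ and the distance (or weight of the pair) is $d(\mathbf a,\mathbf b)=\max(|\mathbf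 a-\gcd(\mathbf a,\mathbf b)|,|\mathbf b-\gcd(\mathbf a,\mathbf b)|)$. For an integer $N\ge0$, an $N$-chain from $\mathbf a$ to $\mathbf b$ is a sequence $\mathbf a_1,\ldots,\mathbf a_k\in\mathsf Z_\Gamma(\alpha)$ with $\mathbf a_1=\mathbf a$, $\mathbf a_k=\mathbf b$, and $d(\mathbf a_{i-1},\mathbf a_i)\le N$ for all $2\le i\le k$. The catenary degree $\mathsf c(\alpha)$ is the smallest non-negative integer $N$ such that there is an $N$-chain between any two factorizations of $\alpha$. A pair $(\mathbf a,\mathbf b)$ of factorizations of $\alpha$ is redundant if there is an $N$-chain from $\mathbf a$ to $\mathbf b$ for some $N<d(\mathbf a,\mathbf b)$. Gradings: an $A$-grading of a $\Bbbk$-algebra $S$ is a decomposition $S\cong\bigoplus_{\alpha\in A}S_\alpha$ into finite-dimensional $\Bbbk$-subspaces with $S_\alpha S_\beta\subset S_{\alpha+\beta}$. An $A$-grading of an $S$-module $M$ is a decomposition $M\cong\bigoplus_{\alpha\in A}M_\alpha$ into $\Bbbk$-subspaces with $S_\alpha M_\beta\subset M_{\alpha+\beta}$; it is modest if $\dim_\Bbbk M_\alpha<\infty$ for all $\alpha$. The Hilbert function is $\mathcal H(M;\alpha)=\dim_\Bbbk M_\alpha$. *)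

theory Defs
  imports
    "HOL-Analysis.Finite_Cartesian_Product"
    "HOL-Library.Product_Plus"
    "HOL-Library.Poly_Mapping"
    "HOL-Algebra.Generated_Rings"
    "Jordan_Normal_Form.Missing_VectorSpace"
begin

section \<open>Affine semigroups and their factorizations\<close>

definition is_submonoid :: "'a::comm_monoid_add set \<Rightarrow> bool" where
  "is_submonoid H \<longleftrightarrow> 0 \<in> H \<and> (\<forall>x\<in>H. \<forall>y\<in>H. x + y \<in> H)"

definition submonoid_gen :: "'a::comm_monoid_add set \<Rightarrow> 'a set" where
  "submonoid_gen S = is_submonoid hull S"

definition reduced :: "'a::comm_monoid_add set \<Rightarrow> bool" where
  "reduced \<Gamma> \<longleftrightarrow> (\<forall>x\<in>\<Gamma>. \<forall>y\<in>\<Gamma>. x + y = 0 \<longrightarrow> x = 0)"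

text \<open>The generators are \<open>g 0, \<dots>, g (r - 1)\<close>; the values \<open>g i\<close> with \<open>i \<ge> r\<close> are irrelevant.\<close>

definition minimally_generates :: "nat \<Rightarrow> (nat \<Rightarrow> 'a::comm_monoid_add) \<Rightarrow> 'a set \<Rightarrow> bool" where
  "minimally_generates r g \<Gamma> \<longleftrightarrow>
     inj_on g {..<r} \<and> submonoid_gen (g ` {..<r}) = \<Gamma> \<and>
     (\<forall>S. S \<subset> g ` {..<r} \<longrightarrow> submonoid_gen S \<noteq> \<Gamma>)"

definition nmult :: "nat \<Rightarrow> 'a::comm_monoid_add \<Rightarrow> 'a" where
  "nmult n x = (\<Sum>_<n. x)"

text \<open>A tuple in \<open>\<nat>\<^sup>r\<close> is a function vanishing from \<open>r\<close> on, so that equality of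
  tuples is equality of functions.\<close>

definition factorizations :: "nat \<Rightarrow> (nat \<Rightarrow> 'a::comm_monoid_add) \<Rightarrow> 'a \<Rightarrow> (nat \<Rightarrow> nat) set" where
  "factorizations r g \<alpha> = {a. (\<forall>i\<ge>r. a i = 0) \<and> \<alpha> = (\<Sum>i<r. nmult (a i) (g i))}"

definition fact_length :: "nat \<Rightarrow> (nat \<Rightarrow> nat) \<Rightarrow> nat" where
  "fact_length r a = (\<Sum>i<r. a i)"

definition fact_gcd :: "(nat \<Rightarrow> nat) \<Rightarrow> (nat \<Rightarrow> nat) \<Rightarrow> nat \<Rightarrow> nat" where
  "fact_gcd a b = (\<lambda>i. min (a i) (b i))"

definition fact_dist :: "nat \<Rightarrow> (nat \<Rightarrow> nat) \<Rightarrow> (nat \<Rightarrow> nat) \<Rightarrow> nat" where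
  "fact_dist r a b =
     max (fact_length r (\<lambda>i. a i - fact_gcd a b i)) (fact_length r (\<lambda>i. b i - fact_gcd a b i))"

definition is_chain ::
  "nat \<Rightarrow> (nat \<Rightarrow> 'a::comm_monoid_add) \<Rightarrow> 'a \<Rightarrow> nat \<Rightarrow> (nat \<Rightarrow> nat) \<Rightarrow> (nat \<Rightarrow> nat) \<Rightarrow> (nat \<Rightarrow> nat) list \<Rightarrow> bool"
where
  "is_chain r g \<alpha> N a b cs \<longleftrightarrow>
     cs \<noteq> [] \<and> hd cs = a \<and> last cs = b \<and> set cs \<subseteq> factorizations r g \<alpha> \<and>
     successively (\<lambda>x y. fact_dist r x y \<le> N) cs"

definition catenary_degree :: "nat \<Rightarrow> (nat \<Rightarrow> 'a::comm_monoid_add) \<Rightarrow> 'a \<Rightarrow> nat" where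
  "catenary_degree r g \<alpha> =
     (LEAST N. \<forall>a\<in>factorizations r g \<alpha>. \<forall>b\<in>factorizations r g \<alpha>. \<exists>cs. is_chain r g \<alpha> N a b cs)"

definition redundant ::
  "nat \<Rightarrow> (nat \<Rightarrow> 'a::comm_monoid_add) \<Rightarrow> 'a \<Rightarrow> (nat \<Rightarrow> nat) \<Rightarrow> (nat \<Rightarrow> nat) \<Rightarrow> bool"
where
  "redundant r g \<alpha> a b \<longleftrightarrow> (\<exists>N<fact_dist r a b. \<exists>cs. is_chain r g \<alpha> N a b cs)"


section \<open>Graded algebras and modules over a field\<close>

text \<open>The type class field \<open>'k\<close> viewed as a ring record.\<close>

definition base_field :: "'k::field ring" where
  "base_field = \<lparr>carrier = UNIV, mult = (*), one = 1, zero = 0, add = (+)\<rparr>"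

text \<open>\<open>V\<close> is the internal direct sum of the \<open>\<Bbbk>\<close>-subspaces \<open>C \<alpha>\<close>.\<close>

definition direct_decomposition :: "('k::field, 'v) module \<Rightarrow> ('a \<Rightarrow> 'v set) \<Rightarrow> bool" where
  "direct_decomposition V C \<longleftrightarrow>
     (\<forall>\<alpha>. VectorSpace.subspace base_field (C \<alpha>) V) \<and>
     (\<forall>v\<in>carrier V. \<exists>!f. (\<forall>\<alpha>. f \<alpha> \<in> C \<alpha>) \<and> finite {\<alpha>. f \<alpha> \<noteq> \<zero>\<^bsub>V\<^esub>} \<and>
        v = (\<Oplus>\<^bsub>V\<^esub>\<alpha>\<in>{\<alpha>. f \<alpha> \<noteq> \<zero>\<^bsub>V\<^esub>}. f \<alpha>))"

definition fin_dim_part :: "('k::field, 'v) module \<Rightarrow> 'v set \<Rightarrow> bool" where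
  "fin_dim_part V W \<longleftrightarrow> vectorspace.fin_dim (base_field :: 'k ring) (V\<lparr>carrier := W\<rparr>)"

definition graded_algebra :: "('k::field, 'v) module \<Rightarrow> ('a::comm_monoid_add \<Rightarrow> 'v set) \<Rightarrow> bool" where
  "graded_algebra R RC \<longleftrightarrow>
     algebra base_field R \<and> direct_decomposition R RC \<and> (\<forall>\<alpha>. fin_dim_part R (RC \<alpha>)) \<and>
     (\<forall>\<alpha> \<beta>. \<forall>x\<in>RC \<alpha>. \<forall>y\<in>RC \<beta>. x \<otimes>\<^bsub>R\<^esub> y \<in> RC (\<alpha> + \<beta>))"

definition fin_gen_algebra :: "('k::field, 'v) module \<Rightarrow> bool" where
  "fin_gen_algebra R \<longleftrightarrow>
     (\<exists>X. finite X \<and> X \<subseteq> carrier R \<and>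
        generate_ring R (range (\<lambda>c. c \<odot>\<^bsub>R\<^esub> \<one>\<^bsub>R\<^esub>) \<union> X) = carrier R)"

text \<open>The \<open>\<Bbbk>\<close>-vector space underlying an \<open>R\<close>-module, where \<open>R\<close> is a \<open>\<Bbbk>\<close>-algebra.\<close>

definition restrict_scalars :: "('k::field, 'v) module \<Rightarrow> ('v, 'm) module \<Rightarrow> ('k, 'm) module" where
  "restrict_scalars R M =
     \<lparr>carrier = carrier M, mult = mult M, one = one M, zero = zero M, add = add M,
      smult = (\<lambda>c x. (c \<odot>\<^bsub>R\<^esub> \<one>\<^bsub>R\<^esub>) \<odot>\<^bsub>M\<^esub> x)\<rparr>"

definition graded_module ::
  "('k::field, 'v) module \<Rightarrow> ('a::comm_monoid_add \<Rightarrow> 'v set) \<Rightarrow> ('v, 'm) module \<Rightarrow> ('a \<Rightarrow> 'm set) \<Rightarrow> bool"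
where
  "graded_module R RC M MC \<longleftrightarrow>
     Module.module R M \<and> direct_decomposition (restrict_scalars R M) MC \<and>
     (\<forall>\<alpha> \<beta>. \<forall>x\<in>RC \<alpha>. \<forall>m\<in>MC \<beta>. x \<odot>\<^bsub>M\<^esub> m \<in> MC (\<alpha> + \<beta>))"

definition modest :: "('k::field, 'v) module \<Rightarrow> ('v, 'm) module \<Rightarrow> ('a \<Rightarrow> 'm set) \<Rightarrow> bool" where
  "modest R M MC \<longleftrightarrow> (\<forall>\<alpha>. fin_dim_part (restrict_scalars R M) (MC \<alpha>))"

definition fin_gen_module :: "('v, 'z) ring_scheme \<Rightarrow> ('v, 'm) module \<Rightarrow> bool" where
  "fin_gen_module R M \<longleftrightarrow>
     (\<exists>X. finite X \<and> X \<subseteq> carrier M \<and> LinearCombinations.module.span R M X = carrier M)"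

definition hilbert_fun ::
  "('k::field, 'v) module \<Rightarrow> ('v, 'm) module \<Rightarrow> ('a \<Rightarrow> 'm set) \<Rightarrow> 'a \<Rightarrow> nat"
where
  "hilbert_fun R M MC \<alpha> =
     vectorspace.dim (base_field :: 'k ring) ((restrict_scalars R M)\<lparr>carrier := MC \<alpha>\<rparr>)"

text \<open>
  An existential statement about rings and modules has to name the types of their carriers. The
  type of polynomials in countably many variables contains an isomorphic copy of the underlying
  \<open>\<Bbbk>\<close>-vector space of every algebra or module of countable dimension, in particular of every
  finitely generated \<open>\<Bbbk>\<close>-algebra and every finitely generated module over one. Hence asking for
  carriers in this type, or in the larger type of sets of polynomials (which also accommodates
  quotients formed from cosets), is no restriction.
\<close>

type_synonym 'k mpoly = "(nat \<Rightarrow>\<^sub>0 nat) \<Rightarrow>\<^sub>0 'k"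

end

theory Submission
  imports Defs
begin

text \<open>
  The idea is to let the monomials of \<open>M\<^sub>j\<close> be the non-redundant pairs \<open>(a, b)\<close> of factorizations at
  distance \<open>j\<close>, and to let the polynomial ring \<open>R = \<Bbbk>[x\<^sub>1, \<dots>, x\<^sub>r]\<close>, graded by sending \<open>x\<^sub>i\<close> to the
  generator \<open>\<alpha>\<^sub>i\<close>, act by translation: \<open>x\<^sup>c (a, b) = (a + c, b + c)\<close> if the translate is still
  non-redundant, and \<open>0\<close> otherwise. By construction \<open>M\<^sub>j\<close> is non-zero in degree \<open>\<alpha>\<close> exactly if \<open>\<alpha>\<close>
  has a non-redundant pair at distance \<open>j\<close>. Three facts make this work.

  First, translation preserves distances, and it carries chains to chains. Hence, once a pair has
  become redundant, all its translates are redundant; the redundant pairs span a submodule of the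
  module of all pairs at distance \<open>j\<close>, and \<open>M\<^sub>j\<close> is the quotient
  (\<open>pair_exponents_cancel\<close>, \<open>module_truncated_module\<close>).

  Second, every pair is a translate of its reduced pair \<open>(a - gcd(a, b), b - gcd(a, b))\<close>, which has the
  same distance. At distance \<open>j\<close> both entries of the reduced pair have length at most \<open>j\<close>, so there
  are only finitely many of them, and they generate \<open>M\<^sub>j\<close>
  (\<open>finite_coprime_pair_exponents\<close>, \<open>fin_gen_truncated_module\<close>).

  Third, every element has only finitely many factorizations, because in a reduced monoid no
  generator can be pure torsion (\<open>finite_factorizations\<close>). This gives finite-dimensional graded pieces,
  for \<open>R\<close> as well as for \<open>M\<^sub>j\<close>.

  For the statement on the catenary degree \<open>c(\<alpha>)\<close>, a non-redundant pair at distance \<open>j\<close> is not joined by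
  an \<open>N\<close>-chain with \<open>N < j\<close>, so \<open>j \<le> c(\<alpha>)\<close>. Conversely, a chain witnessing a positive \<open>c(\<alpha>)\<close> has a
  link that no \<open>N\<close>-chain with \<open>N < c(\<alpha>)\<close> bridges, and this link is a non-redundant pair at distance \<open>c(\<alpha>)\<close>
  (\<open>catenary_degree_attained\<close>). The value \<open>1\<close> does not occur, because distances between factorizations
  over a minimal generating set are never \<open>1\<close> (\<open>fact_dist_neq_1\<close>).
\<close>

section \<open>Vector spaces spanned by monomials\<close>

lemma poly_mapping_induct_on [consumes 1, case_names zero single add]:
  fixes p :: "'b \<Rightarrow>\<^sub>0 'c::comm_monoid_add"
  assumes "Poly_Mapping.keys p \<subseteq> B"
    and zero: "P 0"
    and single: "\<And>k c. k \<in> B \<Longrightarrow> P (Poly_Mapping.single k c)"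
    and add: "\<And>p q. Poly_Mapping.keys p \<subseteq> B \<Longrightarrow> Poly_Mapping.keys q \<subseteq> B \<Longrightarrow>
                P p \<Longrightarrow> P q \<Longrightarrow> P (p + q)"
  shows "P p"
proof -
  have "P p" if "finite F" "F \<subseteq> B" "Poly_Mapping.keys p \<subseteq> F" for F and p :: "'b \<Rightarrow>\<^sub>0 'c"
    using that
  proof (induction F arbitrary: p rule: finite_induct)
    case empty
    then have "p = 0"
      by (intro poly_mapping_eqI) (auto simp: in_keys_iff)
    with zero show ?case by simp
  next
    case (insert k F)
    let ?q = "Poly_Mapping.mapp (\<lambda>l c. c when l \<noteq> k) p"
    have q: "Poly_Mapping.keys ?q \<subseteq> F"
      using insert.prems by (auto simp: in_keys_iff lookup_mapp when_def subset_iff split: if_splits)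
    have "p = Poly_Mapping.single k (Poly_Mapping.lookup p k) + ?q"
      by (intro poly_mapping_eqI) (auto simp: lookup_add lookup_mapp lookup_single when_def in_keys_iff)
    moreover have "P (Poly_Mapping.single k (Poly_Mapping.lookup p k) + ?q)"
    proof (rule add)
      show "Poly_Mapping.keys (Poly_Mapping.single k (Poly_Mapping.lookup p k)) \<subseteq> B"
        using insert.prems by (auto split: if_splits)
      show "Poly_Mapping.keys ?q \<subseteq> B" using q insert.prems by blast
      show "P (Poly_Mapping.single k (Poly_Mapping.lookup p k))"
        using insert.prems by (intro single) auto
      show "P ?q" using q insert.prems by (intro insert.IH) auto
    qed
    ultimately show ?case by simp
  qed
  from this[OF finite_keys assms(1) subset_refl] show ?thesis .
qed

definition polys_on :: "'b set \<Rightarrow> ('b \<Rightarrow>\<^sub>0 'k::zero) set" where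
  "polys_on B = {p. Poly_Mapping.keys p \<subseteq> B}"

lemma polys_on_iff: "p \<in> polys_on B \<longleftrightarrow> (\<forall>b. b \<notin> B \<longrightarrow> Poly_Mapping.lookup p b = 0)"
  by (auto simp: polys_on_def in_keys_iff subset_iff)

lemma polys_on_zero [simp]: "0 \<in> polys_on B"
  by (simp add: polys_on_def)

lemma polys_on_single [simp]: "Poly_Mapping.single k c \<in> polys_on B \<longleftrightarrow> c = 0 \<or> k \<in> B"
  by (simp add: polys_on_def)

lemma polys_on_add [simp]: "p \<in> polys_on B \<Longrightarrow> q \<in> polys_on B \<Longrightarrow> p + q \<in> polys_on B"
  using Poly_Mapping.keys_add[of p q] by (auto simp: polys_on_def)

lemma polys_on_uminus [simp]: "p \<in> polys_on B \<Longrightarrow> - p \<in> polys_on B"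
  for p :: "'b \<Rightarrow>\<^sub>0 'k::ab_group_add"
  by (simp add: polys_on_iff)

lemma polys_on_mono: "B \<subseteq> B' \<Longrightarrow> p \<in> polys_on B \<Longrightarrow> p \<in> polys_on B'"
  by (auto simp: polys_on_def)

lemma lookup_scale [simp]:
  "Poly_Mapping.lookup (Poly_Mapping.single 0 c * p) k = c * Poly_Mapping.lookup p k"
  for c :: "'k::comm_semiring_0"
  by (subst mult_map_scale_conv_mult[symmetric]) (simp add: Poly_Mapping.map.rep_eq when_def)

lemma polys_on_scale [simp]: "p \<in> polys_on B \<Longrightarrow> Poly_Mapping.single 0 c * p \<in> polys_on B"
  for c :: "'k::comm_semiring_0"
  by (simp add: polys_on_iff)

lemma base_field_simps [simp]:
  "carrier base_field = UNIV" "mult base_field = (*)" "one base_field = 1"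
  "zero base_field = 0" "add base_field = (+)"
  by (simp_all add: base_field_def)

lemma field_base_field: "Ring.field (base_field :: 'k::field ring)"
proof -
  have c: "cring (base_field :: 'k ring)"
  proof (intro cringI abelian_groupI comm_monoidI)
    fix x :: 'k
    show "\<exists>y\<in>carrier base_field. y \<oplus>\<^bsub>base_field\<^esub> x = \<zero>\<^bsub>base_field\<^esub>"
      by (rule bexI[of _ "- x"]) simp_all
  qed (simp_all add: algebra_simps)
  show ?thesis
  proof (rule cring.cring_fieldI[OF c])
    have "x \<in> Units (base_field :: 'k ring)" if "x \<noteq> 0" for x :: 'k
      using that by (auto simp: Units_def intro!: exI[of _ "inverse x"])
    moreover have "x \<noteq> 0" if "x \<in> Units (base_field :: 'k ring)" for x :: 'k
      using that by (auto simp: Units_def)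
    ultimately show "Units (base_field :: 'k ring) = carrier base_field - {\<zero>\<^bsub>base_field\<^esub>}"
      by auto
  qed
qed

text \<open>A space with a copy \<open>\<iota>\<close> of the monomials in \<open>B\<close> as basis. The ring of the theorem consists
  of polynomials, whereas its modules have to consist of sets of polynomials; the map \<open>\<iota>\<close> lets both
  share the linear algebra below (\<open>\<iota> p = p\<close> for the ring, \<open>\<iota> p = {p}\<close> for the modules).\<close>

locale monomial_space =
  fixes V :: "('k::field, 'v) module" and \<iota> :: "('b::comm_monoid_add \<Rightarrow>\<^sub>0 'k) \<Rightarrow> 'v"
    and B :: "'b set"
  assumes inj_\<iota>: "inj \<iota>"
    and carrier_V: "carrier V = \<iota> ` polys_on B"
    and zero_V: "\<zero>\<^bsub>V\<^esub> = \<iota> 0"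
    and add_V: "p \<in> polys_on B \<Longrightarrow> q \<in> polys_on B \<Longrightarrow> \<iota> p \<oplus>\<^bsub>V\<^esub> \<iota> q = \<iota> (p + q)"
    and smult_V: "p \<in> polys_on B \<Longrightarrow> c \<odot>\<^bsub>V\<^esub> \<iota> p = \<iota> (Poly_Mapping.single 0 c * p)"
begin

lemma abelian_group: "abelian_group V"
proof (rule abelian_groupI)
  fix x assume "x \<in> carrier V"
  then obtain p where "p \<in> polys_on B" "x = \<iota> p" by (auto simp: carrier_V)
  then show "\<exists>y\<in>carrier V. y \<oplus>\<^bsub>V\<^esub> x = \<zero>\<^bsub>V\<^esub>"
    by (intro bexI[of _ "\<iota> (- p)"]) (auto simp: carrier_V zero_V add_V)
next
  fix x y z assume "x \<in> carrier V" "y \<in> carrier V" "z \<in> carrier V"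
  then obtain p q r where "p \<in> polys_on B" "x = \<iota> p" "q \<in> polys_on B" "y = \<iota> q"
      "r \<in> polys_on B" "z = \<iota> r"
    by (auto simp: carrier_V)
  then show "x \<oplus>\<^bsub>V\<^esub> y \<oplus>\<^bsub>V\<^esub> z = x \<oplus>\<^bsub>V\<^esub> (y \<oplus>\<^bsub>V\<^esub> z)" "x \<oplus>\<^bsub>V\<^esub> y = y \<oplus>\<^bsub>V\<^esub> x"
      "\<zero>\<^bsub>V\<^esub> \<oplus>\<^bsub>V\<^esub> x = x" "x \<oplus>\<^bsub>V\<^esub> y \<in> carrier V"
    by (simp_all add: carrier_V zero_V add_V add_ac)
qed (simp add: carrier_V zero_V)

lemma vectorspace: "vectorspace base_field V"
proof (rule vectorspace.intro)
  interpret K: field "base_field :: 'k ring" by (rule field_base_field)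
  show "Module.module base_field V"
  proof (rule moduleI[OF K.is_cring abelian_group])
    fix a b :: 'k and x assume "x \<in> carrier V"
    then obtain p where p: "p \<in> polys_on B" "x = \<iota> p" by (auto simp: carrier_V)
    then show "(a \<oplus>\<^bsub>base_field\<^esub> b) \<odot>\<^bsub>V\<^esub> x = a \<odot>\<^bsub>V\<^esub> x \<oplus>\<^bsub>V\<^esub> b \<odot>\<^bsub>V\<^esub> x"
      by (simp add: smult_V add_V single_add distrib_right)
    from p show "(a \<otimes>\<^bsub>base_field\<^esub> b) \<odot>\<^bsub>V\<^esub> x = a \<odot>\<^bsub>V\<^esub> (b \<odot>\<^bsub>V\<^esub> x)"
      by (simp add: smult_V mult_single mult.assoc[symmetric])
    from p show "a \<odot>\<^bsub>V\<^esub> x \<in> carrier V" "\<one>\<^bsub>base_field\<^esub> \<odot>\<^bsub>V\<^esub> x = x"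
      by (simp_all add: smult_V carrier_V)
    fix y assume "y \<in> carrier V"
    then obtain q where "q \<in> polys_on B" "y = \<iota> q" by (auto simp: carrier_V)
    with p show "a \<odot>\<^bsub>V\<^esub> (x \<oplus>\<^bsub>V\<^esub> y) = a \<odot>\<^bsub>V\<^esub> x \<oplus>\<^bsub>V\<^esub> a \<odot>\<^bsub>V\<^esub> y"
      by (simp add: smult_V add_V distrib_left)
  qed
  show "Ring.field (base_field :: 'k ring)" by (rule field_base_field)
qed

lemma monomial_space_subset:
  assumes "B' \<subseteq> B"
  shows "monomial_space (V\<lparr>carrier := \<iota> ` polys_on B'\<rparr>) \<iota> B'"
proof -
  have "p \<in> polys_on B" if "p \<in> polys_on B'" for p :: "'b \<Rightarrow>\<^sub>0 'k"
    using polys_on_mono[OF assms that] .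
  then show ?thesis by unfold_locales (auto simp: inj_\<iota> zero_V add_V smult_V)
qed

lemma subspace:
  assumes "B' \<subseteq> B"
  shows "VectorSpace.subspace base_field (\<iota> ` polys_on B') V"
proof (intro subspace.intro vectorspace submodule.intro)
  have sub: "p \<in> polys_on B" if "p \<in> polys_on B'" for p :: "'b \<Rightarrow>\<^sub>0 'k"
    using polys_on_mono[OF assms that] .
  show "\<iota> ` polys_on B' \<subseteq> carrier V" "\<zero>\<^bsub>V\<^esub> \<in> \<iota> ` polys_on B'"
    using sub by (auto simp: carrier_V zero_V)
  show "v \<oplus>\<^bsub>V\<^esub> w \<in> \<iota> ` polys_on B'" if "v \<in> \<iota> ` polys_on B'" "w \<in> \<iota> ` polys_on B'" for v w
    using that sub by (auto simp: add_V)
  show "c \<odot>\<^bsub>V\<^esub> v \<in> \<iota> ` polys_on B'" if "v \<in> \<iota> ` polys_on B'" for c v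
    using that sub by (auto simp: smult_V)
  show "Module.module base_field V" using vectorspace by (simp add: vectorspace_def)
qed

lemma finsum_V:
  assumes "finite F" "\<And>i. i \<in> F \<Longrightarrow> h i \<in> polys_on B"
  shows "(\<Oplus>\<^bsub>V\<^esub>i\<in>F. \<iota> (h i)) = \<iota> (\<Sum>i\<in>F. h i) \<and> (\<Sum>i\<in>F. h i) \<in> polys_on B"
  using assms
proof (induction F rule: finite_induct)
  interpret abelian_group V by (rule abelian_group)
  case empty
  show ?case by (simp add: zero_V)
next
  interpret abelian_group V by (rule abelian_group)
  case (insert i F)
  then show ?case by (subst finsum_insert) (auto simp: carrier_V add_V)
qed

text \<open>Any weight on the exponents grades the space: the component of \<open>p\<close> in degree \<open>\<alpha>\<close> keeps exactly
  the terms of weight \<open>\<alpha>\<close>. Uniqueness is read off from the coefficients, since the coefficient at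
  \<open>b\<close> can only come from the component of degree \<open>wt b\<close>.\<close>

lemma direct_decomposition:
  "direct_decomposition V (\<lambda>\<alpha>. \<iota> ` polys_on {b \<in> B. wt b = \<alpha>})"
  unfolding direct_decomposition_def
proof (intro conjI allI ballI)
  show "VectorSpace.subspace base_field (\<iota> ` polys_on {b \<in> B. wt b = \<alpha>}) V" for \<alpha>
    by (rule subspace) auto
next
  fix v assume "v \<in> carrier V"
  then obtain p where p: "p \<in> polys_on B" and v: "v = \<iota> p" by (auto simp: carrier_V)
  have \<iota>_eq: "\<iota> q = \<iota> q' \<longleftrightarrow> q = q'" for q q' using inj_\<iota> by (rule inj_eq)
  define h where "h \<alpha> = Poly_Mapping.mapp (\<lambda>b c. c when wt b = \<alpha>) p" for \<alpha>
  have lookup_h: "Poly_Mapping.lookup (h \<alpha>) b = (Poly_Mapping.lookup p b when wt b = \<alpha>)" for \<alpha> b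
    by (auto simp: h_def lookup_mapp when_def in_keys_iff)
  have h_in: "h \<alpha> \<in> polys_on {b \<in> B. wt b = \<alpha>}" for \<alpha>
    using p by (auto simp: polys_on_iff lookup_h when_def)
  have supp: "{\<alpha>. \<iota> (h \<alpha>) \<noteq> \<zero>\<^bsub>V\<^esub>} = wt ` Poly_Mapping.keys p"
  proof -
    have "Poly_Mapping.keys (h \<alpha>) = {b \<in> Poly_Mapping.keys p. wt b = \<alpha>}" for \<alpha>
      by (auto simp: lookup_h in_keys_iff when_def split: if_splits)
    moreover have "h \<alpha> = 0 \<longleftrightarrow> Poly_Mapping.keys (h \<alpha>) = {}" for \<alpha>
      by simp
    ultimately show ?thesis by (auto simp: zero_V \<iota>_eq)
  qed
  have h_inB: "h \<alpha> \<in> polys_on B" for \<alpha>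
    by (rule polys_on_mono[OF _ h_in]) auto
  have sum_h: "(\<Sum>\<alpha>\<in>wt ` Poly_Mapping.keys p. h \<alpha>) = p"
  proof (rule poly_mapping_eqI)
    fix b
    show "Poly_Mapping.lookup (\<Sum>\<alpha>\<in>wt ` Poly_Mapping.keys p. h \<alpha>) b = Poly_Mapping.lookup p b"
      by (cases "b \<in> Poly_Mapping.keys p")
        (auto simp: lookup_sum lookup_h when_def sum.delta' in_keys_iff)
  qed
  show "\<exists>!f. (\<forall>\<alpha>. f \<alpha> \<in> \<iota> ` polys_on {b \<in> B. wt b = \<alpha>}) \<and> finite {\<alpha>. f \<alpha> \<noteq> \<zero>\<^bsub>V\<^esub>} \<and>
          v = (\<Oplus>\<^bsub>V\<^esub>\<alpha>\<in>{\<alpha>. f \<alpha> \<noteq> \<zero>\<^bsub>V\<^esub>}. f \<alpha>)"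
  proof (rule ex1I[of _ "\<lambda>\<alpha>. \<iota> (h \<alpha>)"])
    show "(\<forall>\<alpha>. \<iota> (h \<alpha>) \<in> \<iota> ` polys_on {b \<in> B. wt b = \<alpha>}) \<and>
        finite {\<alpha>. \<iota> (h \<alpha>) \<noteq> \<zero>\<^bsub>V\<^esub>} \<and> v = (\<Oplus>\<^bsub>V\<^esub>\<alpha>\<in>{\<alpha>. \<iota> (h \<alpha>) \<noteq> \<zero>\<^bsub>V\<^esub>}. \<iota> (h \<alpha>))"
      unfolding supp using h_in finsum_V[of "wt ` Poly_Mapping.keys p" h] h_inB
      by (auto simp: sum_h v)
  next
    fix f
    assume f: "(\<forall>\<alpha>. f \<alpha> \<in> \<iota> ` polys_on {b \<in> B. wt b = \<alpha>}) \<and> finite {\<alpha>. f \<alpha> \<noteq> \<zero>\<^bsub>V\<^esub>} \<and>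
          v = (\<Oplus>\<^bsub>V\<^esub>\<alpha>\<in>{\<alpha>. f \<alpha> \<noteq> \<zero>\<^bsub>V\<^esub>}. f \<alpha>)"
    then have "\<forall>\<alpha>. \<exists>q. q \<in> polys_on {b \<in> B. wt b = \<alpha>} \<and> f \<alpha> = \<iota> q" by blast
    then have "\<exists>q. \<forall>\<alpha>. q \<alpha> \<in> polys_on {b \<in> B. wt b = \<alpha>} \<and> f \<alpha> = \<iota> (q \<alpha>)"
      by (rule choice)
    then obtain q where q: "\<And>\<alpha>. q \<alpha> \<in> polys_on {b \<in> B. wt b = \<alpha>}" and fq: "f = (\<lambda>\<alpha>. \<iota> (q \<alpha>))"
      by auto
    have q_inB: "q \<alpha> \<in> polys_on B" for \<alpha>
      by (rule polys_on_mono[OF _ q]) auto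
    let ?S = "{\<alpha>. q \<alpha> \<noteq> 0}"
    have S: "{\<alpha>. f \<alpha> \<noteq> \<zero>\<^bsub>V\<^esub>} = ?S" by (simp add: fq zero_V \<iota>_eq)
    have fin: "finite ?S" using f S by simp
    have "v = (\<Oplus>\<^bsub>V\<^esub>\<alpha>\<in>?S. f \<alpha>)" using f unfolding S by blast
    also have "\<dots> = \<iota> (\<Sum>\<alpha>\<in>?S. q \<alpha>)"
      unfolding fq by (rule conjunct1[OF finsum_V]) (use fin q_inB in auto)
    finally have "\<iota> p = \<iota> (\<Sum>\<alpha>\<in>?S. q \<alpha>)" by (simp add: v)
    then have p_eq: "p = (\<Sum>\<alpha>\<in>?S. q \<alpha>)" by (simp add: \<iota>_eq)
    have "q \<alpha> = h \<alpha>" for \<alpha>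
    proof (rule poly_mapping_eqI)
      fix b
      have off: "Poly_Mapping.lookup (q \<beta>) b = 0" if "wt b \<noteq> \<beta>" for \<beta>
        using q[of \<beta>] that by (simp add: polys_on_iff)
      have "Poly_Mapping.lookup p b = (\<Sum>\<beta>\<in>?S. Poly_Mapping.lookup (q \<beta>) b)"
        by (subst p_eq) (simp add: lookup_sum)
      also have "\<dots> = (\<Sum>\<beta>\<in>?S. if \<beta> = wt b then Poly_Mapping.lookup (q (wt b)) b else 0)"
        by (rule sum.cong) (auto simp: off)
      also have "\<dots> = Poly_Mapping.lookup (q (wt b)) b"
        using fin by (simp add: sum.delta)
      finally show "Poly_Mapping.lookup (q \<alpha>) b = Poly_Mapping.lookup (h \<alpha>) b"
        by (auto simp: lookup_h when_def off)
    qed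
    then show "f = (\<lambda>\<alpha>. \<iota> (h \<alpha>))" by (simp add: fq)
  qed
qed

lemma span_monomials:
  "LinearCombinations.module.span base_field V ((\<lambda>b. \<iota> (Poly_Mapping.single b 1)) ` B) = carrier V"
    (is "module.span _ _ ?X = _")
proof -
  interpret V: vectorspace base_field V by (rule vectorspace)
  have X: "?X \<subseteq> carrier V" by (auto simp: carrier_V)
  interpret S: submodule base_field "V.span ?X" V by (rule V.span_is_submodule[OF X])
  have "\<iota> p \<in> V.span ?X" if "Poly_Mapping.keys p \<subseteq> B" for p
    using that
  proof (induction rule: poly_mapping_induct_on)
    case zero
    show ?case using S.zero_closed by (simp add: zero_V)
  next
    case (single k c)
    have "\<iota> (Poly_Mapping.single k 1) \<in> V.span ?X"
      using V.in_own_span[OF X] single by blast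
    then have "c \<odot>\<^bsub>V\<^esub> \<iota> (Poly_Mapping.single k 1) \<in> V.span ?X" by simp
    then show ?case using single by (simp add: smult_V mult_single)
  next
    case (add p q)
    then show ?case using S.m_closed[of "\<iota> p" "\<iota> q"] by (simp add: add_V polys_on_def)
  qed
  then show ?thesis using S.subset by (auto simp: carrier_V polys_on_def)
qed

lemma fin_dim:
  assumes "finite B"
  shows "vectorspace.fin_dim base_field V"
proof -
  interpret V: vectorspace base_field V by (rule vectorspace)
  show ?thesis unfolding V.fin_dim_def
    using assms span_monomials
    by (intro exI[of _ "(\<lambda>b. \<iota> (Poly_Mapping.single b 1)) ` B"]) (auto simp: carrier_V)
qed

text \<open>A space of dimension \<open>0\<close> is spanned by the empty set, hence contains no monomial.\<close>

lemma dim_pos_iff: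
  assumes "finite B"
  shows "vectorspace.dim base_field V > 0 \<longleftrightarrow> B \<noteq> {}"
proof -
  interpret V: vectorspace base_field V by (rule vectorspace)
  have "V.dim = 0 \<longleftrightarrow> B = {}"
  proof
    assume "V.dim = 0"
    let ?P = "\<lambda>n. \<exists>A. finite A \<and> card A = n \<and> A \<subseteq> carrier V \<and> V.span A = carrier V"
    obtain A where "finite A" "A \<subseteq> carrier V" "V.span A = carrier V"
      using fin_dim[OF assms] unfolding V.fin_dim_def by blast
    then have "?P (card A)" by blast
    then have "?P V.dim" unfolding V.dim_def by (rule LeastI)
    then obtain A where "finite A" "card A = V.dim" "V.span A = carrier V" by blast
    with \<open>V.dim = 0\<close> have "A = {}" "V.span A = carrier V" by simp_all
    then have "carrier V = {\<zero>\<^bsub>V\<^esub>}" using V.span_empty by simp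
    then have carrier_0: "carrier V = {\<iota> 0}" by (simp only: zero_V)
    have single_0: "Poly_Mapping.single b (1::'k) = 0" if "b \<in> B" for b
    proof -
      have "\<iota> (Poly_Mapping.single b 1) \<in> carrier V"
        unfolding carrier_V by (rule imageI) (simp add: that)
      then show ?thesis unfolding carrier_0 by (simp add: inj_eq[OF inj_\<iota>])
    qed
    have False if "b \<in> B" for b
      using arg_cong[OF single_0[OF that], of "\<lambda>p. Poly_Mapping.lookup p b"] by simp
    then show "B = {}" by blast
  next
    assume "B = {}"
    with span_monomials have "V.span {} = carrier V" by (simp only: image_empty)
    then have "\<exists>A. finite A \<and> card A = 0 \<and> A \<subseteq> carrier V \<and> V.span A = carrier V"
      by (intro exI[of _ "{}"] conjI) auto
    then show "V.dim = 0" unfolding V.dim_def by (rule Least_eq_0)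
  qed
  then show ?thesis by (simp only: neq0_conv[symmetric])
qed

lemma fin_dim_part:
  assumes "B' \<subseteq> B" "finite B'"
  shows "fin_dim_part V (\<iota> ` polys_on B')"
  unfolding fin_dim_part_def
  by (rule monomial_space.fin_dim[OF monomial_space_subset]) (use assms in auto)

end

section \<open>Monoid algebras\<close>

lemma is_submonoid_submonoid_gen: "is_submonoid (submonoid_gen S)"
  unfolding submonoid_gen_def is_submonoid_def hull_def by auto

lemma submonoid_gen_superset: "S \<subseteq> submonoid_gen S"
  unfolding submonoid_gen_def by (rule hull_subset)

lemma submonoid_gen_minimal: "S \<subseteq> H \<Longrightarrow> is_submonoid H \<Longrightarrow> submonoid_gen S \<subseteq> H"
  unfolding submonoid_gen_def by (rule hull_minimal)

definition monoid_algebra :: "'b::comm_monoid_add set \<Rightarrow> ('k::field, 'b \<Rightarrow>\<^sub>0 'k) module" where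
  "monoid_algebra C = \<lparr>carrier = polys_on C, mult = (*), one = 1, zero = 0, add = (+),
     smult = (\<lambda>c p. Poly_Mapping.single 0 c * p)\<rparr>"

lemma monoid_algebra_simps [simp]:
  "carrier (monoid_algebra C) = polys_on C" "mult (monoid_algebra C) = (*)"
  "one (monoid_algebra C) = 1" "zero (monoid_algebra C) = 0" "add (monoid_algebra C) = (+)"
  "c \<odot>\<^bsub>monoid_algebra C\<^esub> p = Poly_Mapping.single 0 c * p"
  by (simp_all add: monoid_algebra_def)

lemma monomial_space_monoid_algebra: "monomial_space (monoid_algebra C) (\<lambda>p. p) C"
  by unfold_locales simp_all

lemma polys_on_one: "is_submonoid C \<Longrightarrow> (1 :: 'b::comm_monoid_add \<Rightarrow>\<^sub>0 'k::field) \<in> polys_on C"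
  by (simp add: is_submonoid_def single_one[symmetric] del: single_one)

lemma polys_on_mult:
  fixes p q :: "'b::comm_monoid_add \<Rightarrow>\<^sub>0 'k::field"
  assumes "p \<in> polys_on B" "q \<in> polys_on B'" "\<And>b b'. b \<in> B \<Longrightarrow> b' \<in> B' \<Longrightarrow> b + b' \<in> D"
  shows "p * q \<in> polys_on D"
  using keys_mult[of p q] assms unfolding polys_on_def by blast

lemma cring_monoid_algebra:
  assumes "is_submonoid C"
  shows "cring (monoid_algebra C :: ('k::field, _) module)"
proof (intro cringI)
  show "abelian_group (monoid_algebra C :: ('k, _) module)"
    by (rule monomial_space.abelian_group[OF monomial_space_monoid_algebra])
  show "Group.comm_monoid (monoid_algebra C :: ('k, _) module)"
    using polys_on_one[OF assms] polys_on_mult[of _ C _ C C] assms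
    by (intro comm_monoidI) (auto simp: mult.assoc mult.commute is_submonoid_def)
qed (simp add: distrib_right)

lemma algebra_monoid_algebra:
  assumes "is_submonoid C"
  shows "algebra base_field (monoid_algebra C :: ('k::field, _) module)"
proof -
  interpret V: vectorspace base_field "monoid_algebra C :: ('k, _) module"
    by (rule monomial_space.vectorspace[OF monomial_space_monoid_algebra])
  show ?thesis
    by (intro algebra.intro V.module_axioms cring_monoid_algebra[OF assms] algebra_axioms.intro)
      (simp add: mult.assoc)
qed

lemma graded_algebra_monoid_algebra:
  fixes wt :: "'b::comm_monoid_add \<Rightarrow> 'a::comm_monoid_add"
  assumes "is_submonoid C"
    and wt_add: "\<And>b b'. wt (b + b') = wt b + wt b'"
    and fin: "\<And>\<alpha>. finite {b \<in> C. wt b = \<alpha>}"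
  shows "graded_algebra (monoid_algebra C :: ('k::field, _) module)
           (\<lambda>\<alpha>. polys_on {b \<in> C. wt b = \<alpha>})"
proof -
  interpret monomial_space "monoid_algebra C :: ('k, _) module" "\<lambda>p. p" C
    by (rule monomial_space_monoid_algebra)
  have "x * y \<in> polys_on {b \<in> C. wt b = \<alpha> + \<beta>}"
    if "x \<in> polys_on {b \<in> C. wt b = \<alpha>}" "y \<in> polys_on {b \<in> C. wt b = \<beta>}"
    for \<alpha> \<beta> and x y :: "'b \<Rightarrow>\<^sub>0 'k"
    using that by (rule polys_on_mult) (use assms(1) in \<open>simp add: is_submonoid_def wt_add\<close>)
  then show ?thesis
    using algebra_monoid_algebra[OF assms(1)] direct_decomposition[of wt]
      fin_dim_part[OF _ fin]
    by (simp add: graded_algebra_def)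
qed

text \<open>The exponents whose monomial lies in the generated ring form a submonoid, so it is enough that
  this submonoid contains the generators of the monoid.\<close>

lemma fin_gen_monoid_algebra:
  assumes "finite X"
  shows "fin_gen_algebra (monoid_algebra (submonoid_gen X) :: ('k::field, _) module)"
proof -
  define C where "C = submonoid_gen X"
  have submonoid: "is_submonoid C"
    unfolding C_def by (rule is_submonoid_submonoid_gen)
  have X_C: "X \<subseteq> C" unfolding C_def by (rule submonoid_gen_superset)
  let ?R = "monoid_algebra C :: ('k, _) module"
  interpret R: cring ?R by (rule cring_monoid_algebra[OF submonoid])
  define H where "H = range (\<lambda>c. c \<odot>\<^bsub>?R\<^esub> \<one>\<^bsub>?R\<^esub>) \<union> (\<lambda>x. Poly_Mapping.single x (1::'k)) ` X"
  have H: "H \<subseteq> carrier ?R"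
    using X_C submonoid by (auto simp: H_def is_submonoid_def)
  let ?G = "generate_ring ?R H"
  have sum_closed: "p + q \<in> ?G" and mult: "p * q \<in> ?G" if "p \<in> ?G" "q \<in> ?G" for p q
    using generate_ring.eng_add[OF that] generate_ring.eng_mult[OF that] by simp_all
  have const: "Poly_Mapping.single 0 c \<in> ?G" for c
    by (rule generate_ring.incl) (auto simp: H_def)
  have monomial: "Poly_Mapping.single b 1 \<in> ?G" if "b \<in> C" for b
  proof -
    let ?S = "{b. Poly_Mapping.single b 1 \<in> ?G}"
    have "X \<subseteq> ?S" by (auto intro: generate_ring.incl simp: H_def)
    moreover have "Poly_Mapping.single (b + b') 1 \<in> ?G"
      if "Poly_Mapping.single b 1 \<in> ?G" "Poly_Mapping.single b' 1 \<in> ?G" for b b'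
      using mult[OF that] by (simp add: mult_single)
    then have "is_submonoid ?S" using const[of 1] by (simp add: is_submonoid_def)
    ultimately have "C \<subseteq> ?S" unfolding C_def by (rule submonoid_gen_minimal)
    with that show ?thesis by blast
  qed
  have "p \<in> ?G" if "Poly_Mapping.keys p \<subseteq> C" for p
    using that
  proof (induction rule: poly_mapping_induct_on)
    case zero
    show ?case using const[of 0] by simp
  next
    case (single b c)
    then show ?case using mult[OF const[of c] monomial[of b]] by (simp add: mult_single)
  next
    case (add p q)
    then show ?case by (intro sum_closed)
  qed
  then have "?G = carrier ?R"
    using R.generate_ring_incl[OF H] by (auto simp: polys_on_def)
  then show ?thesis
    unfolding fin_gen_algebra_def C_def[symmetric]
    using assms H unfolding H_def
    by (intro exI[of _ "(\<lambda>x. Poly_Mapping.single x (1::'k)) ` X"]) simp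
qed

section \<open>Modules with truncated multiplication\<close>

text \<open>The \<open>\<Bbbk>\<close>-linear projection onto the span of the monomials in \<open>B\<close> that kills all others.\<close>

definition truncate :: "'b set \<Rightarrow> ('b \<Rightarrow>\<^sub>0 'k::zero) \<Rightarrow> ('b \<Rightarrow>\<^sub>0 'k)" where
  "truncate B = Poly_Mapping.mapp (\<lambda>b c. c when b \<in> B)"

lemma lookup_truncate [simp]:
  "Poly_Mapping.lookup (truncate B p) b = (Poly_Mapping.lookup p b when b \<in> B)"
  by (simp add: truncate_def lookup_mapp when_def in_keys_iff)

lemma truncate_in [simp]: "truncate B p \<in> polys_on B"
  by (simp add: polys_on_iff)

lemma truncate_id [simp]: "p \<in> polys_on B \<Longrightarrow> truncate B p = p"
  by (rule poly_mapping_eqI) (simp add: polys_on_iff when_def)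

lemma truncate_add: "truncate B (p + q) = truncate B p + truncate B q"
  for p q :: "'b \<Rightarrow>\<^sub>0 'k::comm_monoid_add"
  by (rule poly_mapping_eqI) (simp add: lookup_add when_def)

text \<open>The condition on \<open>B\<close> says that a monomial outside \<open>B\<close> stays outside when multiplied by a monomial
  from \<open>C\<close>. The monomials outside \<open>B\<close> therefore span a \<open>\<Bbbk>[C]\<close>-submodule, and the product can be
  computed modulo it.\<close>

lemma truncate_mult_truncate:
  fixes p q :: "'b::comm_monoid_add \<Rightarrow>\<^sub>0 'k::field"
  assumes p: "p \<in> polys_on C"
    and B: "\<And>c e. c \<in> C \<Longrightarrow> c + e \<in> B \<Longrightarrow> e \<in> B"
  shows "truncate B (p * truncate B q) = truncate B (p * q)"
proof -
  define u where "u = truncate (- B) q"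
  have q: "q = truncate B q + u"
    by (rule poly_mapping_eqI) (simp add: u_def lookup_add when_def)
  have "p * u \<in> polys_on (- B)"
    using p B by (intro polys_on_mult[of p C u "- B"]) (auto simp: u_def)
  then have "truncate B (p * u) = 0"
    by (intro poly_mapping_eqI) (simp add: polys_on_iff when_def)
  then show ?thesis
    by (subst (2) q) (simp add: distrib_left truncate_add)
qed

text \<open>If the monomials outside \<open>B\<close> span a submodule, this is the quotient of the module of all
  polynomials by it, with each coset represented by its unique member in the span of \<open>B\<close>. The members are wrapped as
  singletons so that the carrier consists of sets of polynomials.\<close>

definition truncated_module ::
  "'b::comm_monoid_add set \<Rightarrow> ('b \<Rightarrow>\<^sub>0 'k::field, ('b \<Rightarrow>\<^sub>0 'k) set) module" where
  "truncated_module B = \<lparr>carrier = (\<lambda>p. {p}) ` polys_on B, mult = (\<lambda>x y. undefined),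
     one = undefined, zero = {0}, add = (\<lambda>x y. {the_elem x + the_elem y}),
     smult = (\<lambda>p x. {truncate B (p * the_elem x)})\<rparr>"

lemma truncated_module_simps [simp]:
  "carrier (truncated_module B) = (\<lambda>p. {p}) ` polys_on B" "zero (truncated_module B) = {0}"
  "{p} \<oplus>\<^bsub>truncated_module B\<^esub> {q} = {p + q}"
  "p \<odot>\<^bsub>truncated_module B\<^esub> {q} = {truncate B (p * q)}"
  by (simp_all add: truncated_module_def)

lemma restrict_scalars_simps [simp]:
  "carrier (restrict_scalars R M) = carrier M" "zero (restrict_scalars R M) = zero M"
  "add (restrict_scalars R M) = add M"
  "c \<odot>\<^bsub>restrict_scalars R M\<^esub> x = (c \<odot>\<^bsub>R\<^esub> \<one>\<^bsub>R\<^esub>) \<odot>\<^bsub>M\<^esub> x"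
  by (simp_all add: restrict_scalars_def)

text \<open>Constants act without any truncation, because \<open>c \<cdot> p\<close> has no monomials other than those of \<open>p\<close>.\<close>

lemma monomial_space_truncated_module:
  "monomial_space (restrict_scalars (monoid_algebra C) (truncated_module B)) (\<lambda>p. {p}) B"
  by unfold_locales (auto simp: inj_def)

text \<open>The one axiom that is not formal is \<open>(p q) m = p (q m)\<close>: the right-hand side truncates twice, and
  the inner truncation is harmless by \<open>truncate_mult_truncate\<close>.\<close>

lemma module_truncated_module:
  assumes C: "is_submonoid C"
    and B: "\<And>c e. c \<in> C \<Longrightarrow> c + e \<in> B \<Longrightarrow> e \<in> B"
  shows "Module.module (monoid_algebra C :: ('k::field, _) module) (truncated_module B)"
    (is "Module.module ?R ?M")
proof (rule moduleI)
  show "cring ?R" by (rule cring_monoid_algebra[OF C])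
  show "abelian_group ?M"
  proof (rule abelian_groupI)
    fix x assume "x \<in> carrier ?M"
    then obtain m where "m \<in> polys_on B" "x = {m}" by auto
    then show "\<exists>y\<in>carrier ?M. y \<oplus>\<^bsub>?M\<^esub> x = \<zero>\<^bsub>?M\<^esub>"
      by (intro bexI[of _ "{- m}"]) auto
  qed (auto simp: add_ac)
  show "\<one>\<^bsub>?R\<^esub> \<odot>\<^bsub>?M\<^esub> x = x" if "x \<in> carrier ?M" for x
    using that by auto
  fix p q x
  assume p: "p \<in> carrier ?R" and x: "x \<in> carrier ?M"
  from x obtain m where m: "m \<in> polys_on B" "x = {m}" by auto
  from m show "p \<odot>\<^bsub>?M\<^esub> x \<in> carrier ?M" by auto
  show "(p \<oplus>\<^bsub>?R\<^esub> q) \<odot>\<^bsub>?M\<^esub> x = p \<odot>\<^bsub>?M\<^esub> x \<oplus>\<^bsub>?M\<^esub> q \<odot>\<^bsub>?M\<^esub> x"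
    by (simp add: m distrib_right truncate_add)
  show "(p \<otimes>\<^bsub>?R\<^esub> q) \<odot>\<^bsub>?M\<^esub> x = p \<odot>\<^bsub>?M\<^esub> (q \<odot>\<^bsub>?M\<^esub> x)"
    using p B by (simp add: m truncate_mult_truncate[of p C] mult.assoc)
  fix y assume "y \<in> carrier ?M"
  then show "p \<odot>\<^bsub>?M\<^esub> (x \<oplus>\<^bsub>?M\<^esub> y) = p \<odot>\<^bsub>?M\<^esub> x \<oplus>\<^bsub>?M\<^esub> p \<odot>\<^bsub>?M\<^esub> y"
    by (auto simp: m distrib_left truncate_add)
qed

lemma graded_module_truncated_module:
  fixes wt :: "'b::comm_monoid_add \<Rightarrow> 'a::comm_monoid_add"
  assumes C: "is_submonoid C"
    and B: "\<And>c e. c \<in> C \<Longrightarrow> c + e \<in> B \<Longrightarrow> e \<in> B"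
    and wt_add: "\<And>b b'. wt (b + b') = wt b + wt b'"
  shows "graded_module (monoid_algebra C :: ('k::field, _) module)
           (\<lambda>\<alpha>. polys_on {b \<in> C. wt b = \<alpha>}) (truncated_module B)
           (\<lambda>\<alpha>. (\<lambda>p. {p}) ` polys_on {b \<in> B. wt b = \<alpha>})"
proof -
  have "truncate B (p * q) \<in> polys_on {b \<in> B. wt b = \<alpha> + \<beta>}"
    if "p \<in> polys_on {b \<in> C. wt b = \<alpha>}" "q \<in> polys_on {b \<in> B. wt b = \<beta>}"
    for \<alpha> \<beta> and p q :: "'b \<Rightarrow>\<^sub>0 'k"
  proof -
    have "p * q \<in> polys_on {b. wt b = \<alpha> + \<beta>}"
      using that by (rule polys_on_mult) (simp add: wt_add)
    then show ?thesis by (simp add: polys_on_iff when_def)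
  qed
  then show ?thesis
    unfolding graded_module_def
    using module_truncated_module[OF C B]
      monomial_space.direct_decomposition[OF monomial_space_truncated_module]
    by auto
qed

lemma modest_truncated_module:
  assumes "\<And>\<alpha>. finite {b \<in> B. wt b = \<alpha>}"
  shows "modest (monoid_algebra C :: ('k::field, _) module) (truncated_module B)
           (\<lambda>\<alpha>. (\<lambda>p. {p}) ` polys_on {b \<in> B. wt b = \<alpha>})"
  unfolding modest_def
  by (intro allI monomial_space.fin_dim_part[OF monomial_space_truncated_module]) (use assms in auto)

lemma hilbert_fun_truncated_module:
  assumes "finite {b \<in> B. wt b = \<alpha>}"
  shows "hilbert_fun (monoid_algebra C :: ('k::field, _) module) (truncated_module B)
           (\<lambda>\<alpha>. (\<lambda>p. {p}) ` polys_on {b \<in> B. wt b = \<alpha>}) \<alpha> > 0 \<longleftrightarrow> (\<exists>b\<in>B. wt b = \<alpha>)"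
proof -
  interpret monomial_space "restrict_scalars (monoid_algebra C :: ('k, _) module) (truncated_module B)"
    "\<lambda>p. {p}" B
    by (rule monomial_space_truncated_module)
  show ?thesis
    unfolding hilbert_fun_def
    by (subst monomial_space.dim_pos_iff[OF monomial_space_subset[of "{b \<in> B. wt b = \<alpha>}"] assms]) auto
qed

text \<open>A monomial \<open>c + e\<close> of \<open>B\<close> is the monomial \<open>c\<close> of the algebra applied to the monomial \<open>e\<close>, so
  the monomials in \<open>E\<close> generate.\<close>

lemma fin_gen_truncated_module:
  assumes C: "is_submonoid C"
    and B: "\<And>c e. c \<in> C \<Longrightarrow> c + e \<in> B \<Longrightarrow> e \<in> B"
    and fin: "finite E" and E: "E \<subseteq> B" and gen: "\<And>b. b \<in> B \<Longrightarrow> \<exists>c\<in>C. \<exists>e\<in>E. b = c + e"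
  shows "fin_gen_module (monoid_algebra C :: ('k::field, _) module) (truncated_module B)"
    (is "fin_gen_module ?R ?M")
proof -
  interpret M: Module.module ?R ?M by (rule module_truncated_module[OF C B])
  let ?X = "(\<lambda>e. {Poly_Mapping.single e (1::'k)}) ` E"
  have X: "?X \<subseteq> carrier ?M" using E by auto
  interpret S: submodule ?R "M.span ?X" ?M by (rule M.span_is_submodule[OF X])
  have "{p} \<in> M.span ?X" if "Poly_Mapping.keys p \<subseteq> B" for p
    using that
  proof (induction rule: poly_mapping_induct_on)
    case zero
    show ?case using S.zero_closed by simp
  next
    case (single b c)
    obtain d e where d: "d \<in> C" and e: "e \<in> E" and b: "b = d + e" using gen[OF single] by blast
    have "{Poly_Mapping.single e 1} \<in> M.span ?X"
      using M.in_own_span[OF X] e by blast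
    then have "Poly_Mapping.single d c \<odot>\<^bsub>?M\<^esub> {Poly_Mapping.single e 1} \<in> M.span ?X"
      by (rule S.smult_closed[rotated]) (simp add: d)
    then show ?case using single by (simp add: mult_single b)
  next
    case (add p q)
    then show ?case using S.m_closed[of "{p}" "{q}"] by simp
  qed
  then have "M.span ?X = carrier ?M"
    using S.subset by (auto simp: polys_on_def)
  then show ?thesis
    unfolding fin_gen_module_def using fin X by blast
qed

section \<open>Factorizations, chains and the catenary degree\<close>

lemma nmult_0 [simp]: "nmult 0 x = 0"
  by (simp add: nmult_def)

lemma nmult_Suc [simp]: "nmult (Suc n) x = nmult n x + x"
  by (simp add: nmult_def)

lemma nmult_add: "nmult (m + n) x = nmult m x + nmult n x"
  by (induction n) (simp_all add: add.assoc)

lemma is_submonoid_nmult: "is_submonoid H \<Longrightarrow> x \<in> H \<Longrightarrow> nmult n x \<in> H"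
  by (induction n) (simp_all add: is_submonoid_def)

lemma is_submonoid_sum:
  assumes "is_submonoid H" "\<And>i. i \<in> F \<Longrightarrow> f i \<in> H"
  shows "sum f F \<in> H"
  using assms(2)
  by (induction F rule: infinite_finite_induct) (use assms(1) in \<open>simp_all add: is_submonoid_def\<close>)

lemma fact_gcd_commute: "fact_gcd a b = fact_gcd b a"
  by (simp add: fact_gcd_def min.commute)

lemma fact_dist_commute: "fact_dist r a b = fact_dist r b a"
  by (simp add: fact_dist_def fact_gcd_commute[of a b] max.commute)

lemma fact_dist_self [simp]: "fact_dist r a a = 0"
  by (simp add: fact_dist_def fact_gcd_def fact_length_def)

text \<open>Distances only see the two factorizations after their common part has been removed.\<close>

lemma fact_dist_add_left:
  "fact_dist r (\<lambda>i. c i + a i) (\<lambda>i. c i + b i) = fact_dist r a b"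
proof -
  have "c i + x i - min (c i + x i) (c i + y i) = x i - min (x i) (y i)"
    and "c i + y i - min (c i + x i) (c i + y i) = y i - min (x i) (y i)" for i x y
    by (simp_all add: min_def)
  then show ?thesis by (simp add: fact_dist_def fact_gcd_def)
qed

lemma factorizations_add:
  assumes "c \<in> factorizations r g \<gamma>" "a \<in> factorizations r g \<alpha>"
  shows "(\<lambda>i. c i + a i) \<in> factorizations r g (\<gamma> + \<alpha>)"
  using assms by (simp add: factorizations_def nmult_add sum.distrib)

lemma factorizations_cancel:
  fixes g :: "nat \<Rightarrow> 'a::cancel_comm_monoid_add"
  assumes "c \<in> factorizations r g \<gamma>" "(\<lambda>i. c i + a i) \<in> factorizations r g (\<gamma> + \<alpha>)"
  shows "a \<in> factorizations r g \<alpha>"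
  using assms by (simp add: factorizations_def nmult_add sum.distrib)

lemma is_chain_add:
  assumes c: "c \<in> factorizations r g \<gamma>" and "is_chain r g \<alpha> N a b cs"
  shows "is_chain r g (\<gamma> + \<alpha>) N (\<lambda>i. c i + a i) (\<lambda>i. c i + b i) (map (\<lambda>x i. c i + x i) cs)"
  using assms factorizations_add[OF c]
  by (auto simp: is_chain_def hd_map last_map successively_map fact_dist_add_left)

text \<open>A chain can be translated along with its end points, which makes the redundant pairs of a
  given distance stable under translation; dually, if a translate is non-redundant then so is the
  original pair.\<close>

lemma redundant_add:
  assumes "c \<in> factorizations r g \<gamma>" "redundant r g \<alpha> a b"
  shows "redundant r g (\<gamma> + \<alpha>) (\<lambda>i. c i + a i) (\<lambda>i. c i + b i)"
  using assms(2) is_chain_add[OF assms(1)] unfolding redundant_def fact_dist_add_left by blast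

lemma is_chain_step:
  assumes "a \<in> factorizations r g \<alpha>" "b \<in> factorizations r g \<alpha>" "fact_dist r a b \<le> N"
  shows "is_chain r g \<alpha> N a b [a, b]"
  using assms by (simp add: is_chain_def)

lemma is_chain_append:
  assumes "is_chain r g \<alpha> N a b cs" "is_chain r g \<alpha> N b c ds"
  shows "is_chain r g \<alpha> N a c (cs @ ds)"
  using assms by (auto simp: is_chain_def successively_append_iff)

lemma is_chain_mono:
  assumes "is_chain r g \<alpha> N a b cs" "N \<le> N'"
  shows "is_chain r g \<alpha> N' a b cs"
  using assms by (auto simp: is_chain_def elim!: successively_mono)

text \<open>If every link of an \<open>N\<close>-chain can be bridged by an \<open>M\<close>-chain, concatenating the bridges joins the
  end points by an \<open>M\<close>-chain. Contrapositively, when the end points cannot be joined by an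
  \<open>M\<close>-chain, some single link cannot be bridged either.\<close>

lemma is_chain_refine:
  assumes link: "\<And>x y. x \<in> factorizations r g \<alpha> \<Longrightarrow> y \<in> factorizations r g \<alpha> \<Longrightarrow>
                   fact_dist r x y \<le> N \<Longrightarrow> \<exists>ds. is_chain r g \<alpha> M x y ds"
    and "is_chain r g \<alpha> N a b cs"
  shows "\<exists>ds. is_chain r g \<alpha> M a b ds"
  using assms(2)
proof (induction cs arbitrary: a)
  case Nil
  then show ?case by (simp add: is_chain_def)
next
  case (Cons x cs)
  show ?case
  proof (cases "cs = []")
    case True
    with Cons.prems show ?thesis by (auto simp: is_chain_def intro!: exI[of _ "[a]"])
  next
    case False
    with Cons.prems have "is_chain r g \<alpha> N (hd cs) b cs" "fact_dist r a (hd cs) \<le> N"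
      "a \<in> factorizations r g \<alpha>" "hd cs \<in> factorizations r g \<alpha>"
      by (auto simp: is_chain_def successively_Cons)
    with Cons.IH link show ?thesis by (meson is_chain_append)
  qed
qed

text \<open>Finiteness is what guarantees that the minimum defining the catenary degree exists: the largest
  distance between two factorizations is an admissible \<open>N\<close>.\<close>

lemma catenary_degree_chain:
  assumes fin: "finite (factorizations r g \<alpha>)"
    and ab: "a \<in> factorizations r g \<alpha>" "b \<in> factorizations r g \<alpha>"
  shows "\<exists>cs. is_chain r g \<alpha> (catenary_degree r g \<alpha>) a b cs"
proof -
  let ?Z = "factorizations r g \<alpha>"
  have "finite ((\<lambda>(a, b). fact_dist r a b) ` (?Z \<times> ?Z))" using fin by simp
  then obtain N where "\<And>a b. a \<in> ?Z \<Longrightarrow> b \<in> ?Z \<Longrightarrow> fact_dist r a b \<le> N"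
    unfolding finite_nat_set_iff_bounded_le by auto
  then have "\<exists>N. \<forall>a\<in>?Z. \<forall>b\<in>?Z. \<exists>cs. is_chain r g \<alpha> N a b cs" by (meson is_chain_step)
  from LeastI_ex[OF this] ab show ?thesis unfolding catenary_degree_def by blast
qed

lemma nonredundant_le_catenary_degree:
  assumes "finite (factorizations r g \<alpha>)"
    and "a \<in> factorizations r g \<alpha>" "b \<in> factorizations r g \<alpha>"
    and "\<not> redundant r g \<alpha> a b"
  shows "fact_dist r a b \<le> catenary_degree r g \<alpha>"
  using catenary_degree_chain[OF assms(1-3)] assms(4) unfolding redundant_def by (meson not_le)

text \<open>Write the catenary degree as \<open>M + 1\<close>. Minimality gives two factorizations that no \<open>M\<close>-chain
  joins, and an \<open>(M + 1)\<close>-chain between them has a link that no \<open>M\<close>-chain bridges. The distance of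
  that link is then exactly \<open>M + 1\<close>, and the link is non-redundant.\<close>

lemma catenary_degree_attained:
  assumes fin: "finite (factorizations r g \<alpha>)" and pos: "catenary_degree r g \<alpha> > 0"
  shows "\<exists>a\<in>factorizations r g \<alpha>. \<exists>b\<in>factorizations r g \<alpha>.
           \<not> redundant r g \<alpha> a b \<and> fact_dist r a b = catenary_degree r g \<alpha>"
proof -
  let ?Z = "factorizations r g \<alpha>"
  obtain M where M: "catenary_degree r g \<alpha> = Suc M" using pos by (cases "catenary_degree r g \<alpha>") auto
  have least: "\<exists>a\<in>?Z. \<exists>b\<in>?Z. \<nexists>cs. is_chain r g \<alpha> N a b cs" if "N < Suc M" for N
    using not_less_Least[of N] that unfolding M[symmetric] catenary_degree_def by blast
  obtain a b where ab: "a \<in> ?Z" "b \<in> ?Z" "\<nexists>cs. is_chain r g \<alpha> M a b cs" using least[of M] by blast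
  have "\<exists>cs. is_chain r g \<alpha> (Suc M) a b cs"
    using catenary_degree_chain[OF fin ab(1,2)] M by simp
  then obtain x y where xy: "x \<in> ?Z" "y \<in> ?Z" "fact_dist r x y \<le> Suc M"
      "\<nexists>ds. is_chain r g \<alpha> M x y ds"
    using is_chain_refine[of r g \<alpha> "Suc M" M] ab(3) by blast
  moreover have "\<not> fact_dist r x y \<le> M" using is_chain_step xy by blast
  ultimately have d: "fact_dist r x y = Suc M" by simp
  have "\<not> redundant r g \<alpha> x y"
    unfolding redundant_def d using is_chain_mono xy(4) by (metis less_Suc_eq_le)
  with xy d M show ?thesis by auto
qed

section \<open>Minimal generators and distance one\<close>

text \<open>A generator \<open>0\<close> could be dropped, because every submonoid contains \<open>0\<close> anyway.\<close>

lemma generator_nonzero: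
  assumes "minimally_generates r g \<Gamma>" "i < r"
  shows "g i \<noteq> 0"
proof
  assume 0: "g i = 0"
  let ?S = "g ` {..<r} - {0}"
  have sub: "?S \<subset> g ` {..<r}" using 0 assms(2) by force
  have "submonoid_gen (g ` {..<r}) \<subseteq> submonoid_gen ?S"
    using submonoid_gen_superset[of ?S] is_submonoid_submonoid_gen[of ?S]
    by (intro submonoid_gen_minimal) (auto simp: is_submonoid_def)
  moreover have "submonoid_gen ?S \<subseteq> submonoid_gen (g ` {..<r})"
    using submonoid_gen_superset[of "g ` {..<r}"]
    by (intro submonoid_gen_minimal is_submonoid_submonoid_gen) auto
  ultimately show False
    using assms(1) sub unfolding minimally_generates_def by blast
qed

lemma sum_nmult_length_1:
  assumes "fact_length r a = 1"
  obtains i where "i < r" "a i = 1" "(\<Sum>i<r. nmult (a i) (g i)) = g i"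
proof -
  obtain i where i: "i < r" "a i = 1" "\<And>j. j < r \<Longrightarrow> j \<noteq> i \<Longrightarrow> a j = 0"
    using assms sum_eq_1_iff[of "{..<r}" a] unfolding fact_length_def by auto
  have "(\<Sum>j<r. nmult (a j) (g j)) = (\<Sum>j<r. if j = i then g i else 0)"
    using i by (intro sum.cong) (auto simp: i(3))
  with i that show thesis by simp
qed

lemma sum_nmult_length_0:
  assumes "fact_length r a = 0"
  shows "(\<Sum>i<r. nmult (a i) (g i)) = 0"
  using assms by (simp add: fact_length_def)

text \<open>After cancelling the common part, two factorizations at distance \<open>1\<close> would give \<open>\<alpha>\<^sub>i = \<alpha>\<^sub>k\<close> for two
  different generators, or \<open>\<alpha>\<^sub>i = 0\<close>. So a positive catenary degree is at least \<open>2\<close>.\<close>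

lemma fact_dist_neq_1:
  fixes g :: "nat \<Rightarrow> 'a::cancel_comm_monoid_add"
  assumes gen: "minimally_generates r g \<Gamma>"
    and a: "a \<in> factorizations r g \<alpha>" and b: "b \<in> factorizations r g \<alpha>"
  shows "fact_dist r a b \<noteq> 1"
proof
  assume 1: "fact_dist r a b = 1"
  \<comment> \<open>By symmetry the reduced first factorization may be taken to be the one of length \<open>1\<close>.\<close>
  have one_sided: "False" if a: "a \<in> factorizations r g \<alpha>" and b: "b \<in> factorizations r g \<alpha>"
    and d: "fact_dist r a b = 1" and one: "fact_length r (\<lambda>i. a i - fact_gcd a b i) = 1" for a b
  proof -
    let ?a = "\<lambda>i. a i - fact_gcd a b i" and ?b = "\<lambda>i. b i - fact_gcd a b i"
    have "(\<Sum>i<r. nmult (a i) (g i)) = (\<Sum>i<r. nmult (fact_gcd a b i + ?a i) (g i))"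
      "(\<Sum>i<r. nmult (b i) (g i)) = (\<Sum>i<r. nmult (fact_gcd a b i + ?b i) (g i))"
      by (auto intro!: sum.cong simp: fact_gcd_def)
    with a b have eq: "(\<Sum>i<r. nmult (?a i) (g i)) = (\<Sum>i<r. nmult (?b i) (g i))"
      unfolding nmult_add sum.distrib factorizations_def by simp
    obtain i where i: "i < r" "?a i = 1" "(\<Sum>i<r. nmult (?a i) (g i)) = g i"
      by (rule sum_nmult_length_1[OF one])
    have "fact_length r ?b \<le> 1" using d unfolding fact_dist_def by linarith
    then consider "fact_length r ?b = 0" | "fact_length r ?b = 1" by linarith
    then show False
    proof cases
      case 1
      with eq i sum_nmult_length_0[of r ?b g] generator_nonzero[OF gen] show False by metis
    next
      case 2
      then obtain j where j: "j < r" "?b j = 1" "(\<Sum>i<r. nmult (?b i) (g i)) = g j"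
        by (rule sum_nmult_length_1)
      with eq i have "i = j"
        using gen unfolding minimally_generates_def by (auto dest: inj_onD)
      with i j show False by (simp add: fact_gcd_def min_def split: if_splits)
    qed
  qed
  have "fact_length r (\<lambda>i. a i - fact_gcd a b i) = 1 \<or> fact_length r (\<lambda>i. b i - fact_gcd b a i) = 1"
    using 1 unfolding fact_dist_def fact_gcd_commute[of b a] by linarith
  with one_sided[OF a b 1] one_sided[OF b a] 1 show False by (auto simp: fact_dist_commute[of r b a])
qed

lemma factorizations_in_monoid:
  assumes "minimally_generates r g \<Gamma>" "a \<in> factorizations r g \<alpha>"
  shows "\<alpha> \<in> \<Gamma>"
proof -
  have "(\<Sum>i<r. nmult (a i) (g i)) \<in> submonoid_gen (g ` {..<r})"
    using submonoid_gen_superset[of "g ` {..<r}"]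
    by (intro is_submonoid_sum is_submonoid_nmult is_submonoid_submonoid_gen) auto
  with assms show ?thesis by (simp add: minimally_generates_def factorizations_def)
qed

section \<open>Finiteness of the set of factorizations\<close>

lemma nmult_pair: "nmult n (x, y) = (nmult n x, nmult n y)"
  by (induction n) (simp_all add: zero_prod_def)

lemma nmult_vec: "nmult n (v :: nat ^ 'd) $ l = n * v $ l"
  by (induction n) simp_all

lemma finite_order: "\<exists>n>0. nmult n (t :: 't::{ab_group_add, finite}) = 0"
proof -
  have "\<not> inj (\<lambda>n. nmult n t)"
    using finite_imageD[of "\<lambda>n. nmult n t" UNIV] by auto
  then obtain m n where "nmult m t = nmult n t" "m < n"
    by (metis injI linorder_neqE_nat)
  moreover have "nmult n t = nmult m t + nmult (n - m) t"
    using \<open>m < n\<close> by (simp add: nmult_add[symmetric])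
  ultimately show ?thesis by (intro exI[of _ "n - m"]) simp
qed

text \<open>A generator \<open>x\<close> that is pure torsion would be invertible: \<open>x + k x = 0\<close> for some \<open>k\<close>, so a
  reduced monoid forces \<open>x = 0\<close>.\<close>

lemma generator_fst_nonzero:
  fixes g :: "nat \<Rightarrow> (nat ^ 'd) \<times> 't::{ab_group_add, finite}"
  assumes gen: "minimally_generates r g \<Gamma>" and red: "reduced \<Gamma>" and i: "i < r"
  shows "fst (g i) \<noteq> 0"
proof
  assume 0: "fst (g i) = 0"
  obtain k where k: "nmult (Suc k) (snd (g i)) = 0"
    using finite_order[of "snd (g i)"] by (metis gr0_conv_Suc)
  have zero: "nmult n (0 :: nat ^ 'd) = 0" for n by (induction n) simp_all
  have "nmult (Suc k) (g i) = 0"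
    using nmult_pair[of "Suc k" "fst (g i)" "snd (g i)"] k by (simp only: 0 zero prod.collapse zero_prod_def)
      (simp add: 0[symmetric])
  then have "g i + nmult k (g i) = 0" by (simp add: add.commute)
  moreover have g: "g i \<in> \<Gamma>" "is_submonoid \<Gamma>"
    using gen i submonoid_gen_superset[of "g ` {..<r}"] is_submonoid_submonoid_gen[of "g ` {..<r}"]
    by (auto simp: minimally_generates_def)
  moreover have "nmult k (g i) \<in> \<Gamma>" using g by (intro is_submonoid_nmult)
  ultimately have "g i = 0" using red unfolding reduced_def by blast
  with generator_nonzero[OF gen i] show False by simp
qed

text \<open>Each generator has a positive coordinate in \<open>\<nat>\<^sup>d\<close>, so its multiplicity in a factorization of \<open>\<alpha>\<close>
  is bounded by the coordinates of \<open>\<alpha>\<close>.\<close>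

lemma finite_factorizations:
  fixes g :: "nat \<Rightarrow> (nat ^ 'd) \<times> 't::{ab_group_add, finite}"
  assumes gen: "minimally_generates r g \<Gamma>" and red: "reduced \<Gamma>"
  shows "finite (factorizations r g \<alpha>)"
proof -
  define K where "K = (\<Sum>l\<in>UNIV. fst \<alpha> $ l)"
  have "a i \<le> K" if a: "a \<in> factorizations r g \<alpha>" and i: "i < r" for a i
  proof -
    obtain l where l: "fst (g i) $ l \<noteq> 0"
      using generator_fst_nonzero[OF gen red i] by (auto simp: vec_eq_iff)
    have fst_nmult: "fst (nmult n x) = nmult n (fst x)" for n and x :: "(nat ^ 'd) \<times> 't"
      by (cases x) (simp add: nmult_pair)
    have "a i \<le> a i * fst (g i) $ l" using l by simp
    also have "\<dots> \<le> (\<Sum>i<r. a i * fst (g i) $ l)" using i by (intro member_le_sum) auto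
    also have "\<dots> = fst \<alpha> $ l"
      using a by (simp add: factorizations_def fst_sum fst_nmult nmult_vec)
    also have "\<dots> \<le> K" unfolding K_def by (intro member_le_sum) auto
    finally show ?thesis .
  qed
  then have "factorizations r g \<alpha> \<subseteq> {a. \<forall>i. (i \<in> {..<r} \<longrightarrow> a i \<in> {..K}) \<and> (i \<notin> {..<r} \<longrightarrow> a i = 0)}"
    by (auto simp: factorizations_def)
  then show ?thesis
    by (rule finite_subset) (intro finite_set_of_finite_funs; simp)
qed

section \<open>Exponents that encode pairs of factorizations\<close>

lemma finite_bounded_exponents:
  "finite {e :: nat \<Rightarrow>\<^sub>0 nat. Poly_Mapping.keys e \<subseteq> {..<n} \<and> (\<forall>i. Poly_Mapping.lookup e i \<le> m)}"
    (is "finite ?E")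
proof (rule finite_imageD)
  have "Poly_Mapping.lookup ` ?E \<subseteq>
      {f. \<forall>i. (i \<in> {..<n} \<longrightarrow> f i \<in> {..m}) \<and> (i \<notin> {..<n} \<longrightarrow> f i = 0)}"
    by (auto simp: in_keys_iff subset_iff)
  then show "finite (Poly_Mapping.lookup ` ?E)"
    by (rule finite_subset) (intro finite_set_of_finite_funs; simp)
  show "inj_on Poly_Mapping.lookup ?E" by (intro inj_onI poly_mapping_eqI) simp
qed

definition ring_exponents :: "nat \<Rightarrow> (nat \<Rightarrow>\<^sub>0 nat) set" where
  "ring_exponents r = {c. Poly_Mapping.keys c \<subseteq> {..<r}}"

text \<open>A pair \<open>(a, b)\<close> of factorizations is stored as one exponent in \<open>3 r\<close> variables: the positions
  \<open>i\<close>, \<open>r + i\<close> and \<open>2 r + i\<close> (with \<open>i < r\<close>) hold \<open>gcd(a, b)\<close>, \<open>a - gcd(a, b)\<close> and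
  \<open>b - gcd(a, b)\<close> at \<open>i\<close>. With this choice of coordinates, translating the pair by \<open>c\<close> is nothing but
  adding the exponent \<open>c\<close> in the first \<open>r\<close> variables, that is, ordinary multiplication by the
  monomial \<open>c\<close>. The factor at offset \<open>s\<close> recovers \<open>a\<close> (\<open>s = r\<close>) or \<open>b\<close> (\<open>s = 2 r\<close>).\<close>

definition factor_at :: "nat \<Rightarrow> nat \<Rightarrow> (nat \<Rightarrow>\<^sub>0 nat) \<Rightarrow> nat \<Rightarrow> nat" where
  "factor_at r s e = (\<lambda>i. if i < r then Poly_Mapping.lookup e i + Poly_Mapping.lookup e (s + i) else 0)"

abbreviation left_factor :: "nat \<Rightarrow> (nat \<Rightarrow>\<^sub>0 nat) \<Rightarrow> nat \<Rightarrow> nat" where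
  "left_factor r \<equiv> factor_at r r"

abbreviation right_factor :: "nat \<Rightarrow> (nat \<Rightarrow>\<^sub>0 nat) \<Rightarrow> nat \<Rightarrow> nat" where
  "right_factor r \<equiv> factor_at r (2 * r)"

text \<open>The degree is taken from the left factor. On exponents that code a pair of factorizations of
  \<open>\<alpha>\<close> both factors give \<open>\<alpha>\<close>, and on exponents of the ring the left factor is the exponent
  itself, so one weight grades the ring and all modules.\<close>

definition exponent_degree :: "nat \<Rightarrow> (nat \<Rightarrow> 'a::comm_monoid_add) \<Rightarrow> (nat \<Rightarrow>\<^sub>0 nat) \<Rightarrow> 'a" where
  "exponent_degree r g e = (\<Sum>i<r. nmult (left_factor r e i) (g i))"

text \<open>The codes of the non-redundant pairs at distance \<open>j\<close>. The second condition says that nothing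
  common is left in \<open>a - gcd(a, b)\<close> and \<open>b - gcd(a, b)\<close>, so that every pair has only one code.\<close>

definition pair_exponents ::
  "nat \<Rightarrow> (nat \<Rightarrow> 'a::comm_monoid_add) \<Rightarrow> nat \<Rightarrow> (nat \<Rightarrow>\<^sub>0 nat) set" where
  "pair_exponents r g j = {e.
     Poly_Mapping.keys e \<subseteq> {..<3 * r} \<and>
     (\<forall>i<r. Poly_Mapping.lookup e (r + i) = 0 \<or> Poly_Mapping.lookup e (2 * r + i) = 0) \<and>
     right_factor r e \<in> factorizations r g (exponent_degree r g e) \<and>
     fact_dist r (left_factor r e) (right_factor r e) = j \<and>
     \<not> redundant r g (exponent_degree r g e) (left_factor r e) (right_factor r e)}"

lemma lookup_ring_exponent:
  "c \<in> ring_exponents r \<Longrightarrow> r \<le> i \<Longrightarrow> Poly_Mapping.lookup c i = 0"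
  by (auto simp: ring_exponents_def in_keys_iff subset_iff)

lemma is_submonoid_ring_exponents: "is_submonoid (ring_exponents r)"
proof -
  have "Poly_Mapping.keys (c + c') \<subseteq> {..<r}"
    if "Poly_Mapping.keys c \<subseteq> {..<r}" "Poly_Mapping.keys c' \<subseteq> {..<r}" for c c' :: "nat \<Rightarrow>\<^sub>0 nat"
    using Poly_Mapping.keys_add[of c c'] that by blast
  then show ?thesis by (simp add: is_submonoid_def ring_exponents_def)
qed

lemma submonoid_gen_variables:
  "submonoid_gen ((\<lambda>i. Poly_Mapping.single i 1) ` {..<r}) = ring_exponents r"
    (is "submonoid_gen ?X = _")
proof
  show "submonoid_gen ?X \<subseteq> ring_exponents r"
    by (rule submonoid_gen_minimal[OF _ is_submonoid_ring_exponents]) (auto simp: ring_exponents_def)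
  have "c \<in> submonoid_gen ?X" if "Poly_Mapping.keys c \<subseteq> {..<r}" for c
    using that
  proof (induction rule: poly_mapping_induct_on)
    case zero
    show ?case using is_submonoid_submonoid_gen[of ?X] by (simp add: is_submonoid_def)
  next
    case (single i n)
    have "Poly_Mapping.single i 1 \<in> submonoid_gen ?X"
      using submonoid_gen_superset[of ?X] single by blast
    then have "nmult n (Poly_Mapping.single i (1::nat)) \<in> submonoid_gen ?X"
      by (rule is_submonoid_nmult[OF is_submonoid_submonoid_gen])
    moreover have "nmult n (Poly_Mapping.single i (1::nat)) = Poly_Mapping.single i n"
    proof (induction n)
      case (Suc n)
      then show ?case using single_add[of i n 1] by simp
    qed simp
    ultimately show ?case by simp
  next
    case (add c c')
    then show ?case using is_submonoid_submonoid_gen[of ?X] by (simp add: is_submonoid_def)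
  qed
  then show "ring_exponents r \<subseteq> submonoid_gen ?X" by (auto simp: ring_exponents_def)
qed

lemma exponent_degree_add:
  "exponent_degree r g (c + e) = exponent_degree r g c + exponent_degree r g e"
proof -
  have "left_factor r (c + e) i = left_factor r c i + left_factor r e i" for i
    by (simp add: factor_at_def lookup_add)
  then show ?thesis by (simp add: exponent_degree_def nmult_add sum.distrib)
qed

lemma left_factor_in: "left_factor r e \<in> factorizations r g (exponent_degree r g e)"
  by (simp add: factorizations_def exponent_degree_def factor_at_def)

lemma factor_at_ring_exponent:
  assumes "c \<in> ring_exponents r" "r \<le> s"
  shows "factor_at r s c = Poly_Mapping.lookup c"
  using lookup_ring_exponent[OF assms(1)] assms(2) by (auto simp: factor_at_def)

lemma factor_at_add:
  assumes "c \<in> ring_exponents r" "r \<le> s"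
  shows "factor_at r s (c + e) = (\<lambda>i. Poly_Mapping.lookup c i + factor_at r s e i)"
  using lookup_ring_exponent[OF assms(1)] assms(2) by (auto simp: factor_at_def lookup_add)

lemma lookup_ring_exponent_in:
  "c \<in> ring_exponents r \<Longrightarrow> Poly_Mapping.lookup c \<in> factorizations r g (exponent_degree r g c)"
  using left_factor_in[of r c g] by (simp add: factor_at_ring_exponent)

text \<open>This is the hypothesis under which the truncated multiplication is a module structure. It is here
  that the translation invariance of distances and the stability of redundancy under translation
  enter, together with cancellation in the ambient monoid: if \<open>(c + a, c + b)\<close> is a pair of factorizations, then so is \<open>(a, b)\<close>.\<close>

lemma pair_exponents_cancel:
  fixes g :: "nat \<Rightarrow> 'a::cancel_comm_monoid_add"
  assumes c: "c \<in> ring_exponents r" and ce: "c + e \<in> pair_exponents r g j"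
  shows "e \<in> pair_exponents r g j"
proof -
  note c' = lookup_ring_exponent_in[OF c, of g]
  note left = factor_at_add[OF c, of r e, simplified]
    and right = factor_at_add[OF c, of "2 * r" e, simplified]
  have "Poly_Mapping.keys e \<subseteq> Poly_Mapping.keys (c + e)"
    by (simp add: subset_iff in_keys_iff lookup_add)
  moreover have "Poly_Mapping.keys (c + e) \<subseteq> {..<3 * r}"
    using ce by (simp add: pair_exponents_def)
  ultimately have keys: "Poly_Mapping.keys e \<subseteq> {..<3 * r}" by (rule order_trans)
  have coprime: "\<forall>i<r. Poly_Mapping.lookup e (r + i) = 0 \<or> Poly_Mapping.lookup e (2 * r + i) = 0"
    using ce by (auto simp: pair_exponents_def lookup_add)
  have in_fact: "right_factor r e \<in> factorizations r g (exponent_degree r g e)"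
    by (rule factorizations_cancel[OF c']) (use ce in \<open>simp add: pair_exponents_def exponent_degree_add right\<close>)
  have nonred: "\<not> redundant r g (exponent_degree r g e) (left_factor r e) (right_factor r e)"
  proof
    assume "redundant r g (exponent_degree r g e) (left_factor r e) (right_factor r e)"
    from redundant_add[OF c' this] ce show False
      by (simp add: pair_exponents_def exponent_degree_add left right)
  qed
  have dist: "fact_dist r (left_factor r e) (right_factor r e) = j"
    using ce by (simp add: pair_exponents_def left right fact_dist_add_left)
  from keys coprime in_fact nonred dist show ?thesis
    unfolding pair_exponents_def by (intro CollectI conjI)
qed

text \<open>The common part of a coded pair is the minimum of the two factors, so the code can be recovered
  from the pair.\<close>

lemma inj_on_factors:
  "inj_on (\<lambda>e. (left_factor r e, right_factor r e)) (pair_exponents r g j)"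
proof (rule inj_onI)
  fix e e' assume e: "e \<in> pair_exponents r g j" and e': "e' \<in> pair_exponents r g j"
    and eq: "(left_factor r e, right_factor r e) = (left_factor r e', right_factor r e')"
  let ?l = "Poly_Mapping.lookup"
  have common: "?l e i = min (left_factor r e i) (right_factor r e i)"
    if "i < r" "e \<in> pair_exponents r g j" for i e
  proof -
    have "?l e (r + i) = 0 \<or> ?l e (2 * r + i) = 0"
      using that by (simp add: pair_exponents_def)
    then show ?thesis using that(1) by (auto simp: factor_at_def)
  qed
  have eq_common: "?l e i = ?l e' i" if "i < r" for i
    using common[OF that e] common[OF that e'] eq by simp
  have eq_left: "?l e (r + i) = ?l e' (r + i)" and eq_right: "?l e (2 * r + i) = ?l e' (2 * r + i)"
    if "i < r" for i
  proof -
    have "left_factor r e i = left_factor r e' i" "right_factor r e i = right_factor r e' i"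
      using eq by simp_all
    with that eq_common[OF that]
    show "?l e (r + i) = ?l e' (r + i)" "?l e (2 * r + i) = ?l e' (2 * r + i)"
      by (simp_all add: factor_at_def)
  qed
  show "e = e'"
  proof (rule poly_mapping_eqI)
    fix k
    consider "k < r" | "r \<le> k" "k < 2 * r" | "2 * r \<le> k" "k < 3 * r" | "3 * r \<le> k" by linarith
    then show "?l e k = ?l e' k"
    proof cases
      case 1 then show ?thesis by (rule eq_common)
    next
      case 2 then show ?thesis using eq_left[of "k - r"] by simp
    next
      case 3 then show ?thesis using eq_right[of "k - 2 * r"] by simp
    next
      case 4
      then have "k \<notin> Poly_Mapping.keys e" "k \<notin> Poly_Mapping.keys e'"
        using e e' by (auto simp: pair_exponents_def)
      then show ?thesis by (simp add: in_keys_iff)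
    qed
  qed
qed

lemma right_factor_in:
  "e \<in> pair_exponents r g j \<Longrightarrow> right_factor r e \<in> factorizations r g (exponent_degree r g e)"
  by (simp add: pair_exponents_def)

lemma finite_pair_exponents_degree:
  assumes fin: "finite (factorizations r g \<alpha>)"
  shows "finite {e \<in> pair_exponents r g j. exponent_degree r g e = \<alpha>}" (is "finite ?E")
proof -
  let ?f = "\<lambda>e. (left_factor r e, right_factor r e)"
  have inj: "inj_on ?f ?E" 
    using inj_on_factors[of r g j] Collect_restrict by (rule inj_on_subset)
  have "?f ` ?E \<subseteq> factorizations r g \<alpha> \<times> factorizations r g \<alpha>"
  proof (rule image_subsetI)
    fix e assume "e \<in> ?E"
    then have "e \<in> pair_exponents r g j" and deg: "exponent_degree r g e = \<alpha>" by simp_all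
    from left_factor_in[of r e g] right_factor_in[OF this(1)]
    show "?f e \<in> factorizations r g \<alpha> \<times> factorizations r g \<alpha>"
      by (simp only: deg mem_Times_iff fst_conv snd_conv simp_thms)
  qed
  then have "finite (?f ` ?E)" by (rule finite_subset) (intro finite_cartesian_product fin)
  then show ?thesis using inj by (rule finite_imageD)
qed

lemma finite_ring_exponents_degree:
  assumes fin: "finite (factorizations r g \<alpha>)"
  shows "finite {c \<in> ring_exponents r. exponent_degree r g c = \<alpha>}" (is "finite ?C")
proof -
  have "Poly_Mapping.lookup ` ?C \<subseteq> factorizations r g \<alpha>"
    by clarify (rule lookup_ring_exponent_in)
  then have "finite (Poly_Mapping.lookup ` ?C)" by (rule finite_subset) (rule fin)
  moreover have "inj_on Poly_Mapping.lookup ?C" by (intro inj_onI poly_mapping_eqI) simp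
  ultimately show ?thesis by (rule finite_imageD)
qed

lemma pair_exponents_degree_iff:
  "(\<exists>e\<in>pair_exponents r g j. exponent_degree r g e = \<alpha>) \<longleftrightarrow>
     (\<exists>a\<in>factorizations r g \<alpha>. \<exists>b\<in>factorizations r g \<alpha>.
        \<not> redundant r g \<alpha> a b \<and> fact_dist r a b = j)" (is "?L \<longleftrightarrow> ?R")
proof
  assume ?L
  then obtain e where "e \<in> pair_exponents r g j" "exponent_degree r g e = \<alpha>" by blast
  with left_factor_in[of r e g] show ?R
    by (intro bexI[of _ "left_factor r e"] bexI[of _ "right_factor r e"])
      (simp_all add: pair_exponents_def)
next
  assume ?R
  then obtain a b where a: "a \<in> factorizations r g \<alpha>" and b: "b \<in> factorizations r g \<alpha>"
    and nonred: "\<not> redundant r g \<alpha> a b" and d: "fact_dist r a b = j" by blast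
  \<comment> \<open>The subtractions truncate at \<open>0\<close>, so they are \<open>a - gcd(a, b)\<close> and \<open>b - gcd(a, b)\<close>.\<close>
  define f where "f i = (if i < r then min (a i) (b i)
      else if i < 2 * r then a (i - r) - b (i - r)
      else if i < 3 * r then b (i - 2 * r) - a (i - 2 * r) else 0)" for i
  define e where "e = Abs_poly_mapping f"
  have "finite {i. f i \<noteq> 0}"
    by (rule finite_subset[of _ "{..<3 * r}"]) (auto simp: f_def split: if_splits)
  then have lookup_e: "Poly_Mapping.lookup e = f" by (simp add: e_def)
  have left: "left_factor r e = a" and right: "right_factor r e = b"
    using a b by (auto simp: factor_at_def lookup_e f_def factorizations_def fun_eq_iff)
  have deg: "exponent_degree r g e = \<alpha>"
    using a by (simp add: exponent_degree_def left factorizations_def)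
  have keys: "Poly_Mapping.keys e \<subseteq> {..<3 * r}"
    by (auto simp: in_keys_iff lookup_e f_def split: if_splits)
  have coprime: "\<forall>i<r. Poly_Mapping.lookup e (r + i) = 0 \<or> Poly_Mapping.lookup e (2 * r + i) = 0"
    by (auto simp: lookup_e f_def)
  have "e \<in> pair_exponents r g j"
    using b nonred d keys coprime by (simp add: pair_exponents_def left right deg)
  with deg show ?L by blast
qed

text \<open>Without a common part, the distance of a pair bounds the length of both factorizations. This is the
  source of finite generation: only finitely many pairs at distance \<open>j\<close> are not translates of
  smaller ones.\<close>

lemma finite_coprime_pair_exponents:
  "finite {e \<in> pair_exponents r g j. \<forall>i<r. Poly_Mapping.lookup e i = 0}" (is "finite ?E")
proof (rule finite_subset[OF _ finite_bounded_exponents[of "3 * r" j]], clarify, intro conjI allI)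
  fix e
  assume e: "e \<in> pair_exponents r g j" and coprime: "\<forall>i<r. Poly_Mapping.lookup e i = 0"
  let ?l = "Poly_Mapping.lookup e"
  from e show keys: "Poly_Mapping.keys e \<subseteq> {..<3 * r}" by (simp add: pair_exponents_def)
  have "left_factor r e i - fact_gcd (left_factor r e) (right_factor r e) i = ?l (r + i)"
    "right_factor r e i - fact_gcd (left_factor r e) (right_factor r e) i = ?l (2 * r + i)"
    if "i < r" for i
    using e coprime that by (auto simp: pair_exponents_def fact_gcd_def factor_at_def min_def)
  then have "max (\<Sum>i<r. ?l (r + i)) (\<Sum>i<r. ?l (2 * r + i)) = j"
    using e by (simp add: pair_exponents_def fact_dist_def fact_length_def)
  moreover have "?l (s + i) \<le> (\<Sum>i<r. ?l (s + i))" if "i < r" for s i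
    using that by (intro member_le_sum) auto
  ultimately have bounds: "?l (r + i) \<le> j" "?l (2 * r + i) \<le> j" if "i < r" for i
    using that by (meson max.cobounded1 max.cobounded2 order_trans)+
  fix k
  consider "k < r" | "r \<le> k" "k < 2 * r" | "2 * r \<le> k" "k < 3 * r" | "3 * r \<le> k" by linarith
  then show "?l k \<le> j"
  proof cases
    case 1 then show ?thesis using coprime by simp
  next
    case 2 then show ?thesis using bounds(1)[of "k - r"] by simp
  next
    case 3 then show ?thesis using bounds(2)[of "k - 2 * r"] by simp
  next
    case 4
    then have "k \<notin> Poly_Mapping.keys e" using keys by auto
    then show ?thesis by (simp add: in_keys_iff)
  qed
qed

lemma pair_exponents_split:
  fixes g :: "nat \<Rightarrow> 'a::cancel_comm_monoid_add"
  assumes b: "b \<in> pair_exponents r g j"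
  shows "\<exists>c\<in>ring_exponents r. \<exists>e\<in>{e \<in> pair_exponents r g j. \<forall>i<r. Poly_Mapping.lookup e i = 0}.
           b = c + e"
proof -
  define c where "c = Poly_Mapping.mapp (\<lambda>i n. n when i < r) b"
  define e where "e = Poly_Mapping.mapp (\<lambda>i n. n when \<not> i < r) b"
  have lookup_c: "Poly_Mapping.lookup c i = (Poly_Mapping.lookup b i when i < r)"
    and lookup_e: "Poly_Mapping.lookup e i = (Poly_Mapping.lookup b i when \<not> i < r)" for i
    by (simp_all add: c_def e_def lookup_mapp when_def in_keys_iff)
  have b_eq: "b = c + e"
    by (rule poly_mapping_eqI) (simp add: lookup_add lookup_c lookup_e when_def)
  have c: "c \<in> ring_exponents r"
    by (auto simp: ring_exponents_def in_keys_iff lookup_c when_def split: if_splits)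
  have "e \<in> pair_exponents r g j"
    using b pair_exponents_cancel[OF c] by (simp add: b_eq)
  with c b_eq show ?thesis by (intro bexI[of _ c] bexI[of _ e]) (auto simp: lookup_e)
qed

section \<open>The Hilbert functions of the modules of non-redundant pairs\<close>

theorem theorem6p4:
  fixes g :: "nat \<Rightarrow> (nat ^ 'd) \<times> 't::{ab_group_add, finite}"
    and r :: nat
    and \<Gamma> :: "((nat ^ 'd) \<times> 't) set"
  assumes "minimally_generates r g \<Gamma>"
    and "reduced \<Gamma>"
  shows "\<exists>(R :: ('k::field, 'k mpoly) module) RC
           (M :: nat \<Rightarrow> ('k mpoly, 'k mpoly set) module) MC.
      graded_algebra R RC \<and> fin_gen_algebra R \<and>
      (\<forall>j\<ge>2. graded_module R RC (M j) (MC j) \<and> modest R (M j) (MC j) \<and> fin_gen_module R (M j)) \<and>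
      (\<forall>j\<ge>2. \<forall>\<alpha> :: (nat ^ 'd) \<times> 't.
         hilbert_fun R (M j) (MC j) \<alpha> > 0 \<longleftrightarrow>
           \<alpha> \<in> \<Gamma> \<and>
           (\<exists>a\<in>factorizations r g \<alpha>. \<exists>b\<in>factorizations r g \<alpha>.
              \<not> redundant r g \<alpha> a b \<and> fact_dist r a b = j)) \<and>
      (\<forall>\<alpha>\<in>\<Gamma>.
         let J = {j. j \<ge> 2 \<and> hilbert_fun R (M j) (MC j) \<alpha> > 0}
         in finite J \<and> catenary_degree r g \<alpha> = (if J = {} then 0 else Max J))"
proof -
  note fin = finite_factorizations[OF assms]
  let ?C = "ring_exponents r" and ?wt = "exponent_degree r g"
  let ?B = "pair_exponents r g"
  define R :: "('k, 'k mpoly) module" where "R = monoid_algebra ?C"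
  define RC :: "(nat ^ 'd) \<times> 't \<Rightarrow> 'k mpoly set" where "RC \<alpha> = polys_on {c \<in> ?C. ?wt c = \<alpha>}" for \<alpha>
  define M :: "nat \<Rightarrow> ('k mpoly, 'k mpoly set) module" where "M j = truncated_module (?B j)" for j
  define MC :: "nat \<Rightarrow> (nat ^ 'd) \<times> 't \<Rightarrow> 'k mpoly set set"
    where "MC j \<alpha> = (\<lambda>p. {p}) ` polys_on {b \<in> ?B j. ?wt b = \<alpha>}" for j \<alpha>
  note C = is_submonoid_ring_exponents[of r]
  have R: "graded_algebra R RC"
    unfolding R_def RC_def using finite_ring_exponents_degree[OF fin]
    by (intro graded_algebra_monoid_algebra C exponent_degree_add)
  have R_fin_gen: "fin_gen_algebra R"
    unfolding R_def submonoid_gen_variables[symmetric] by (rule fin_gen_monoid_algebra) simp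
  have M: "graded_module R RC (M j) (MC j)" for j
    unfolding R_def RC_def M_def MC_def
    by (intro graded_module_truncated_module C exponent_degree_add) (rule pair_exponents_cancel)
  have M_modest: "modest R (M j) (MC j)" for j
    unfolding R_def M_def MC_def
    by (intro modest_truncated_module finite_pair_exponents_degree fin)
  have M_fin_gen: "fin_gen_module R (M j)" for j
    unfolding R_def M_def
    by (rule fin_gen_truncated_module[OF C _ finite_coprime_pair_exponents _ pair_exponents_split])
      (auto intro: pair_exponents_cancel)
  have hilbert: "hilbert_fun R (M j) (MC j) \<alpha> > 0 \<longleftrightarrow>
      (\<exists>a\<in>factorizations r g \<alpha>. \<exists>b\<in>factorizations r g \<alpha>.
         \<not> redundant r g \<alpha> a b \<and> fact_dist r a b = j)" for j \<alpha>
    unfolding R_def M_def MC_def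
    by (subst hilbert_fun_truncated_module[OF finite_pair_exponents_degree[OF fin]])
      (rule pair_exponents_degree_iff)
  have "finite J \<and> catenary_degree r g \<alpha> = (if J = {} then 0 else Max J)"
    if J: "J = {j. j \<ge> 2 \<and> hilbert_fun R (M j) (MC j) \<alpha> > 0}" for J \<alpha>
  proof -
    let ?c = "catenary_degree r g \<alpha>"
    have le: "j \<le> ?c" if "j \<in> J" for j
    proof -
      from that have "hilbert_fun R (M j) (MC j) \<alpha> > 0" by (simp add: J)
      then obtain a b where "a \<in> factorizations r g \<alpha>" "b \<in> factorizations r g \<alpha>"
          "\<not> redundant r g \<alpha> a b" "fact_dist r a b = j"
        unfolding hilbert by (elim bexE conjE)
      then show ?thesis using nonredundant_le_catenary_degree[OF fin, of a \<alpha> b] by simp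
    qed
    then have finJ: "finite J" by (intro finite_subset[of J "{..?c}"]) auto
    show ?thesis
    proof (cases "?c = 0")
      case True
      \<comment> \<open>\<open>J\<close> only contains numbers \<open>j \<ge> 2\<close>, while the catenary degree bounds them by \<open>0\<close>.\<close>
      have "j \<notin> J" for j
      proof
        assume "j \<in> J"
        with le[OF this] True show False by (simp add: J)
      qed
      then have "J = {}" by blast
      then show ?thesis using True by simp
    next
      case False
      then obtain a b where ab: "a \<in> factorizations r g \<alpha>" "b \<in> factorizations r g \<alpha>"
          "\<not> redundant r g \<alpha> a b" "fact_dist r a b = ?c"
        using catenary_degree_attained[OF fin, of \<alpha>] by auto
      then have "?c \<noteq> 1" using fact_dist_neq_1[OF assms(1) ab(1,2)] by simp
      with False have "?c \<ge> 2" by linarith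
      moreover have "hilbert_fun R (M ?c) (MC ?c) \<alpha> > 0"
        unfolding hilbert using ab by (intro bexI conjI)
      ultimately have c_in: "?c \<in> J" by (simp add: J)
      with finJ le have "Max J = ?c" by (intro Max_eqI)
      with finJ c_in show ?thesis by auto
    qed
  qed
  then have catenary: "\<forall>\<alpha>\<in>\<Gamma>.
         let J = {j. j \<ge> 2 \<and> hilbert_fun R (M j) (MC j) \<alpha> > 0}
         in finite J \<and> catenary_degree r g \<alpha> = (if J = {} then 0 else Max J)"
    by (simp add: Let_def)
  have "\<forall>j\<ge>2. \<forall>\<alpha>. hilbert_fun R (M j) (MC j) \<alpha> > 0 \<longleftrightarrow>
      \<alpha> \<in> \<Gamma> \<and> (\<exists>a\<in>factorizations r g \<alpha>. \<exists>b\<in>factorizations r g \<alpha>.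
         \<not> redundant r g \<alpha> a b \<and> fact_dist r a b = j)"
    unfolding hilbert using factorizations_in_monoid[OF assms(1)] by blast
  with R R_fin_gen M M_modest M_fin_gen catenary show ?thesis by blast
qed

end
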